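(* Let $q$ be a prime power, $F=\mathbb F_q$, let $d>k>0$ be integers and let $n>1$ be an integer with $n\mid(q-1)$. Then there exists a generalized weighing matrix $$A\in GW\left(\genfrac{[}{]}{0pt}{}{d}{k}_q,\,q^{k(d-k)};\,n\right),$$ with rows indexed by $X=Gr(d,k,F)$ and columns indexed by $Y=Gr(d,k,F)$, such that $|A|$ is the characteristic matrix of the $GL_d(F)$-orbit of all $(x,y)\in X\times Y$ such that $x\cap y^D=\{0\}$. Moreover, every automorphism in the image of $GL_d(F)\to\mathrm{PermAut}(|A|)$ lifts to an automorphism of $A$.
   Context: $\mu_n\subset\mathbb C^\times$ is the group of $n$-th roots of unity, $\mu_n^+=\{0\}\cup\mu_n$. $GW(N,w;n)$ is the set of $N\times N$ matrices $W$ with entries in $\mu_n^+$ and $WW^*=wI_N$ ($*$ is conjugate-transpose). $|A|$ is the entrywise absolute value. The Gaussian binomial coefficient is $\genfrac{[}{]}{0pt}{}{m}{r}_q=\frac{[m]_q!}{[r]_q!\,[m-r]_q!}$ with $[m]_q=\frac{q^m-1}{q-1}$ and $[m]_q!=[1]_q[2]_q\cdots[m]_q$. $Gr(d,k,F)$ is the set of $k$-dimensional linear subspaces of $F^d$. For $V\subseteq F^d$, $V^D=\{x\in F^d:\sum_iv_ix_i=0\ \forall v\in V\}$. $GL_d(F)$ acts on $X$ by $V\mapsto gV$ and on $Y$ by $V\mapsto(g^{-1})^TV$. $\mathrm{PermAut}(|A|)$ is the group of pairs $(P,Q)$ of permutation matrices (indexed by $X$ and $Y$) with $P|A|Q^*=|A|$;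 $GL_d(F)$ maps to it by the permutation matrices of its actions on $X$ and $Y$. An automorphism of $A$ is a pair $(P,Q)$ of monomial matrices with nonzero entries in $\mu_n$ such that $PAQ^*=A$; it lifts $(|P|,|Q|)\in\mathrm{PermAut}(|A|)$. *)

theory Defs
  imports "HOL-Analysis.Analysis"
begin

subsection \<open>Gaussian binomial coefficients\<close>

definition q_number :: "nat \<Rightarrow> nat \<Rightarrow> real" where
  "q_number q m = (real q ^ m - 1) / (real q - 1)"

definition q_factorial :: "nat \<Rightarrow> nat \<Rightarrow> real" where
  "q_factorial q m = (\<Prod>i = 1..m. q_number q i)"

definition gaussian_binomial :: "nat \<Rightarrow> nat \<Rightarrow> nat \<Rightarrow> real" where
  "gaussian_binomial q m r = q_factorial q m / (q_factorial q r * q_factorial q (m - r))"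

subsection \<open>Complex matrices indexed by sets\<close>

text \<open>
  A matrix with rows indexed by a set \<open>I\<close> and columns indexed by a set \<open>J\<close> is
  represented by a function that vanishes outside \<open>I \<times> J\<close>; this makes equality of such
  matrices plain equality of functions. All index sets in use are finite.
\<close>

definition matrices :: "'i set \<Rightarrow> 'j set \<Rightarrow> ('i \<Rightarrow> 'j \<Rightarrow> complex) set" where
  "matrices I J = {M. \<forall>i j. (i, j) \<notin> I \<times> J \<longrightarrow> M i j = 0}"

text \<open>\<open>mat_prod J M M'\<close> is the product, where \<open>J\<close> indexes the columns of \<open>M\<close> and
  the rows of \<open>M'\<close>.\<close>

definition mat_prod ::
    "'j set \<Rightarrow> ('i \<Rightarrow> 'j \<Rightarrow> complex) \<Rightarrow> ('j \<Rightarrow> 'l \<Rightarrow> complex) \<Rightarrow> 'i \<Rightarrow> 'l \<Rightarrow> complex" where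
  "mat_prod J M M' = (\<lambda>i l. \<Sum>j\<in>J. M i j * M' j l)"

definition conj_transpose :: "('i \<Rightarrow> 'j \<Rightarrow> complex) \<Rightarrow> 'j \<Rightarrow> 'i \<Rightarrow> complex" where
  "conj_transpose M = (\<lambda>j i. cnj (M i j))"

definition scalar_mat :: "'i set \<Rightarrow> complex \<Rightarrow> 'i \<Rightarrow> 'i \<Rightarrow> complex" where
  "scalar_mat I c = (\<lambda>i i'. if i \<in> I \<and> i = i' then c else 0)"

definition abs_mat :: "('i \<Rightarrow> 'j \<Rightarrow> complex) \<Rightarrow> 'i \<Rightarrow> 'j \<Rightarrow> complex" where
  "abs_mat M = (\<lambda>i j. complex_of_real (cmod (M i j)))"

definition char_mat :: "('i \<times> 'j) set \<Rightarrow> 'i \<Rightarrow> 'j \<Rightarrow> complex" where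
  "char_mat S = (\<lambda>i j. if (i, j) \<in> S then 1 else 0)"

subsection \<open>Generalized weighing matrices\<close>

definition roots_of_unity :: "nat \<Rightarrow> complex set" where
  "roots_of_unity n = {z. z \<noteq> 0 \<and> z ^ n = 1}"

text \<open>\<open>GW I J N w n\<close> is the set \<open>GW(N,w;n)\<close> for matrices whose rows and columns are
  indexed by the \<open>N\<close>-element sets \<open>I\<close> and \<open>J\<close>.\<close>

definition GW ::
    "'i set \<Rightarrow> 'j set \<Rightarrow> nat \<Rightarrow> nat \<Rightarrow> nat \<Rightarrow> ('i \<Rightarrow> 'j \<Rightarrow> complex) set" where
  "GW I J N w n =
     {W \<in> matrices I J.
        finite I \<and> card I = N \<and> finite J \<and> card J = N \<and>
        (\<forall>i\<in>I. \<forall>j\<in>J. W i j \<in> insert 0 (roots_of_unity n)) \<and>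
        mat_prod J W (conj_transpose W) = scalar_mat I (of_nat w)}"

subsection \<open>Automorphisms\<close>

text \<open>The permutation matrix of \<open>\<sigma>\<close> sends the basis vector at \<open>j\<close> to the one at \<open>\<sigma> j\<close>,
  so that \<open>\<sigma> \<mapsto> perm_mat I \<sigma>\<close> is multiplicative.\<close>

definition perm_mat :: "'i set \<Rightarrow> ('i \<Rightarrow> 'i) \<Rightarrow> 'i \<Rightarrow> 'i \<Rightarrow> complex" where
  "perm_mat I \<sigma> = (\<lambda>i j. if j \<in> I \<and> i = \<sigma> j then 1 else 0)"

definition perm_matrices :: "'i set \<Rightarrow> ('i \<Rightarrow> 'i \<Rightarrow> complex) set" where
  "perm_matrices I = {perm_mat I \<sigma> | \<sigma>. bij_betw \<sigma> I I}"

definition monomial_matrices :: "nat \<Rightarrow> 'i set \<Rightarrow> ('i \<Rightarrow> 'i \<Rightarrow> complex) set" where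
  "monomial_matrices n I =
     {M \<in> matrices I I.
        (\<forall>i\<in>I. \<exists>!j. j \<in> I \<and> M i j \<noteq> 0) \<and>
        (\<forall>j\<in>I. \<exists>!i. i \<in> I \<and> M i j \<noteq> 0) \<and>
        (\<forall>i\<in>I. \<forall>j\<in>I. M i j \<noteq> 0 \<longrightarrow> M i j \<in> roots_of_unity n)}"

text \<open>\<open>PAQ\<^sup>* = A\<close>\<close>

definition fixes_mat ::
    "'i set \<Rightarrow> 'j set \<Rightarrow> ('i \<Rightarrow> 'j \<Rightarrow> complex) \<Rightarrow>
       ('i \<Rightarrow> 'i \<Rightarrow> complex) \<times> ('j \<Rightarrow> 'j \<Rightarrow> complex) \<Rightarrow> bool" where
  "fixes_mat I J A = (\<lambda>(P, Q). mat_prod J (mat_prod I P A) (conj_transpose Q) = A)"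

definition PermAut ::
    "'i set \<Rightarrow> 'j set \<Rightarrow> ('i \<Rightarrow> 'j \<Rightarrow> complex) \<Rightarrow>
       (('i \<Rightarrow> 'i \<Rightarrow> complex) \<times> ('j \<Rightarrow> 'j \<Rightarrow> complex)) set" where
  "PermAut I J B = {PQ \<in> perm_matrices I \<times> perm_matrices J. fixes_mat I J B PQ}"

definition Automorphisms ::
    "nat \<Rightarrow> 'i set \<Rightarrow> 'j set \<Rightarrow> ('i \<Rightarrow> 'j \<Rightarrow> complex) \<Rightarrow>
       (('i \<Rightarrow> 'i \<Rightarrow> complex) \<times> ('j \<Rightarrow> 'j \<Rightarrow> complex)) set" where
  "Automorphisms n I J A =
     {PQ \<in> monomial_matrices n I \<times> monomial_matrices n J. fixes_mat I J A PQ}"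

subsection \<open>Grassmannians and the action of the general linear group\<close>

definition Gr :: "nat \<Rightarrow> ('f::field ^ 'd) set set" where
  "Gr k = {V. vec.subspace V \<and> vec.dim V = k}"

definition dual_space :: "('f::field ^ 'd) set \<Rightarrow> ('f ^ 'd) set" where
  "dual_space V = {x. \<forall>v\<in>V. (\<Sum>i\<in>UNIV. v $ i * x $ i) = 0}"

definition GL :: "('f::field ^ 'd ^ 'd) set" where
  "GL = {g. invertible g}"

definition act_X :: "'f::field ^ 'd ^ 'd \<Rightarrow> ('f ^ 'd) set \<Rightarrow> ('f ^ 'd) set" where
  "act_X g V = (\<lambda>v. g *v v) ` V"

definition act_Y :: "'f::field ^ 'd ^ 'd \<Rightarrow> ('f ^ 'd) set \<Rightarrow> ('f ^ 'd) set" where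
  "act_Y g V = (\<lambda>v. transpose (matrix_inv g) *v v) ` V"

definition GL_orbit ::
    "('f::field ^ 'd) set \<times> ('f ^ 'd) set \<Rightarrow> (('f ^ 'd) set \<times> ('f ^ 'd) set) set" where
  "GL_orbit = (\<lambda>(x, y). {(act_X g x, act_Y g y) | g. g \<in> GL})"

text \<open>The map from the general linear group to pairs of permutation matrices indexed by
  \<open>X = Gr k\<close> and \<open>Y = Gr k\<close>.\<close>

definition GL_perm ::
    "nat \<Rightarrow> 'f::field ^ 'd ^ 'd \<Rightarrow>
       (('f ^ 'd) set \<Rightarrow> ('f ^ 'd) set \<Rightarrow> complex) \<times>
       (('f ^ 'd) set \<Rightarrow> ('f ^ 'd) set \<Rightarrow> complex)" where
  "GL_perm k g = (perm_mat (Gr k) (act_X g), perm_mat (Gr k) (act_Y g))"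

end

theory Submission
  imports Defs "HOL-Algebra.Multiplicative_Group"
begin

text \<open>
  Fix a set \<open>I\<close> of \<open>k\<close> coordinates and choose for every \<open>k\<close>-dimensional space \<open>x\<close> a basis
  \<open>B\<^sub>x\<close> indexed by \<open>I\<close>. Let \<open>\<psi>\<close> be a nontrivial character of the cyclic group \<open>F - {0}\<close> with values
  in the \<open>n\<close>-th roots of unity, extended by \<open>\<psi> 0 = 0\<close>. The matrix is
  \<open>A x y = \<psi> (det (B\<^sub>x\<^sup>T B\<^sub>y))\<close>.

  The determinant vanishes exactly when some nonzero vector of \<open>x\<close> is orthogonal to \<open>y\<close>
  (\<open>gram_det_nonzero_iff\<close>), so \<open>\<bar>A\<bar>\<close> is the characteristic matrix of the pairs with
  \<open>x \<inter> dual_space y = {0}\<close>. For such a pair the space is the direct sum of \<open>x\<close> and \<open>dual_space y\<close>,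
  and a basis adapted to this decomposition moves the pair to a fixed pair of coordinate spaces;
  hence these pairs are one orbit (\<open>GL_orbit_coordinate_space\<close>).

  The pairing is invariant under \<open>g\<close> on one side and the inverse transpose of \<open>g\<close> on the other,
  and changing a basis multiplies all determinants of its row by one nonzero constant
  (\<open>gram_det_frame_change\<close>). So, with \<open>g\<close> acting on columns by the inverse transpose,
  \<open>A (g x) (g y)\<close> is \<open>A x y\<close> times a root of unity depending on \<open>x\<close> and one depending on \<open>y\<close>,
  which says that \<open>g\<close> lifts to a monomial automorphism.

  The same invariance makes distinct rows \<open>x\<close>, \<open>x'\<close> orthogonal. Choose \<open>c\<close> with \<open>\<psi> c \<noteq> 1\<close>. There is
  a dilation that fixes \<open>x\<close> pointwise and maps \<open>x'\<close> to itself with determinant \<open>c\<close>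
  (\<open>exists_separating_dilation\<close>). Permuting the columns by its transpose leaves the inner product
  \<open>S\<close> of the two rows unchanged, but also multiplies it by the conjugate of \<open>\<psi> c\<close>; hence \<open>S = 0\<close>.

  The size of the matrix and the squared norm \<open>q ^ (k * (d - k))\<close> of a row are both numbers of
  \<open>k\<close>-dimensional spaces that meet a given subspace only in \<open>0\<close>: the zero space in the first case
  and \<open>dual_space x\<close> in the second. They are obtained by counting ordered bases
  (\<open>card_Gr_complementary\<close>).
\<close>

section \<open>Multiplicative characters of finite fields\<close>

text \<open>
  The cyclicity of the multiplicative group is known for fields given as records; here it is
  applied to the record of the operations of the type.
\<close>

lemma finite_field_primitive_element:
  "\<exists>a :: 'f::{field,finite}. a \<noteq> 0 \<and> (\<forall>z. z \<noteq> 0 \<longrightarrow> (\<exists>i. z = a ^ i)) \<and>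
     (\<forall>m. a ^ m = 1 \<longleftrightarrow> (CARD('f) - 1) dvd m)"
proof -
  define R :: "'f ring" where
    "R = \<lparr>carrier = UNIV, monoid.mult = (*), one = 1, ring.zero = 0, add = (+)\<rparr>"
  have "\<exists>y. x + y = 0" for x :: 'f
    using add.right_inverse by blast
  moreover have "\<exists>y. x * y = 1" if "x \<noteq> 0" for x :: 'f
    using right_inverse[OF that] by blast
  ultimately interpret R: field R
    unfolding R_def by unfold_locales (auto simp: algebra_simps Units_def)
  have carr: "carrier R = UNIV" and zero: "\<zero>\<^bsub>R\<^esub> = 0" and one: "\<one>\<^bsub>R\<^esub> = 1"
    and mult: "x \<otimes>\<^bsub>R\<^esub> y = x * y" for x y
    by (simp_all add: R_def)
  have pow: "x [^]\<^bsub>R\<^esub> (i::nat) = x ^ i" for x i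
    by (induction i) (simp_all add: one mult mult.commute)
  interpret G: group "mult_of R"
    by (rule R.field_mult_group)
  have Gcarr: "carrier (mult_of R) = UNIV - {0}"
    by (simp add: carr zero)
  have Gpow: "x [^]\<^bsub>mult_of R\<^esub> (i::nat) = x ^ i" for x i
    by (simp add: nat_pow_mult_of pow)
  have fin: "finite (carrier (mult_of R))"
    by simp
  obtain a where a: "a \<in> carrier (mult_of R)"
      and gen: "carrier (mult_of R) = {a [^]\<^bsub>R\<^esub> i | i::nat. i \<in> UNIV}"
    using R.finite_field_mult_group_has_gen by (auto simp: carr)
  have "G.ord a = card (generate (mult_of R) {a})"
    by (rule G.generate_pow_card[OF a])
  also have "generate (mult_of R) {a} = carrier (mult_of R)"
    unfolding G.generate_pow_on_finite_carrier[OF fin a] by (simp add: gen Gpow pow del: carrier_mult_of)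
  also have "card \<dots> = CARD('f) - 1"
    by (simp only: Gcarr) simp
  finally have ord: "G.ord a = CARD('f) - 1" .
  show ?thesis
  proof (intro exI[of _ a] conjI allI impI)
    show "a \<noteq> 0" using a by (simp only: Gcarr) simp
    show "\<exists>i. z = a ^ i" if "z \<noteq> 0" for z
    proof -
      have "z \<in> carrier (mult_of R)" using that by (simp only: Gcarr) simp
      thus ?thesis unfolding gen by (auto simp: pow)
    qed
    show "a ^ m = 1 \<longleftrightarrow> (CARD('f) - 1) dvd m" for m
      using G.pow_eq_id[OF a, of m] by (simp add: ord Gpow one)
  qed
qed

text \<open>
  With a generator \<open>a\<close> of the multiplicative group and \<open>w\<close> a primitive \<open>n\<close>-th root of unity, the
  character is \<open>a ^ i \<mapsto> w ^ i\<close>.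
\<close>

lemma exists_multiplicative_character:
  fixes n :: nat
  assumes n: "1 < n" and dvd: "n dvd (CARD('f::{field,finite}) - 1)"
  shows "\<exists>\<psi> :: 'f \<Rightarrow> complex.
    (\<forall>x y. \<psi> (x * y) = \<psi> x * \<psi> y) \<and> \<psi> 0 = 0 \<and>
    (\<forall>x. x \<noteq> 0 \<longrightarrow> \<psi> x \<in> roots_of_unity n) \<and> (\<exists>c. c \<noteq> 0 \<and> \<psi> c \<noteq> 1)"
proof -
  obtain a :: 'f where *: "a \<noteq> 0 \<and> (\<forall>z. z \<noteq> 0 \<longrightarrow> (\<exists>i. z = a ^ i)) \<and>
     (\<forall>m. a ^ m = 1 \<longleftrightarrow> (CARD('f) - 1) dvd m)"
    using finite_field_primitive_element[where 'f = 'f] by (rule exE)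
  note a = *[THEN conjunct1] *[THEN conjunct2, THEN conjunct1, rule_format]
    *[THEN conjunct2, THEN conjunct2, rule_format]
  define w where "w = cis (2 * pi / n)"
  have w0: "w \<noteq> 0" by (simp add: w_def)
  have "w ^ n = cis (real n * (2 * pi / real n))"
    unfolding w_def by (rule Complex.DeMoivre)
  hence wn: "w ^ n = 1" using n by simp
  have w1: "w \<noteq> 1"
  proof
    assume "w = 1"
    hence "cos (2 * pi / n) = 1" unfolding w_def by (metis cis.simps(1) one_complex.simps(1))
    moreover have "cos (2 * pi / n) < cos 0"
      by (rule cos_monotone_0_pi) (use n in \<open>auto simp: field_simps\<close>)
    ultimately show False by simp
  qed
  \<comment> \<open>\<open>a\<close> has order \<open>CARD('f) - 1\<close>, a multiple of \<open>n\<close>, so \<open>a ^ i\<close> determines \<open>w ^ i\<close>.\<close>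
  have le: "w ^ i = w ^ j" if "a ^ i = a ^ j" "i \<le> j" for i j
  proof -
    have "a ^ i * a ^ (j - i) = a ^ j"
      using that(2) by (simp only: power_add[symmetric] le_add_diff_inverse)
    hence "a ^ (j - i) = 1" using a(1) that(1) by simp
    hence "n dvd j - i" using a(3)[of "j - i"] dvd_trans[OF dvd] by simp
    then obtain t where "j - i = n * t" ..
    hence "j = i + n * t" using that(2) by simp
    thus ?thesis by (simp only: power_add power_mult wn power_one mult_1_right)
  qed
  have eq: "w ^ i = w ^ j" if "a ^ i = a ^ j" for i j
    using le[OF that] le[OF that[symmetric], symmetric] nat_le_linear by blast
  define \<psi> where "\<psi> z = (if z = 0 then 0 else w ^ (SOME i. z = a ^ i))" for z
  have \<psi>: "\<psi> (a ^ i) = w ^ i" for i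
  proof -
    have "a ^ i = a ^ (SOME j. a ^ i = a ^ j)" by (rule someI[of _ i]) simp
    hence "w ^ i = w ^ (SOME j. a ^ i = a ^ j)" by (rule eq)
    thus ?thesis using a(1) unfolding \<psi>_def by simp
  qed
  show ?thesis
  proof (intro exI[of _ \<psi>] conjI allI impI)
    show "\<psi> 0 = 0" by (simp add: \<psi>_def)
    show "\<psi> (x * y) = \<psi> x * \<psi> y" for x y
    proof (cases "x = 0 \<or> y = 0")
      case True thus ?thesis by (auto simp: \<psi>_def)
    next
      case False
      obtain i where x: "x = a ^ i" using a(2)[of x] False by blast
      obtain j where y: "y = a ^ j" using a(2)[of y] False by blast
      have "\<psi> (x * y) = \<psi> (a ^ (i + j))" by (simp only: x y power_add)
      also have "\<dots> = w ^ (i + j)" by (rule \<psi>)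
      also have "\<dots> = \<psi> x * \<psi> y" by (simp only: x y \<psi> power_add)
      finally show ?thesis .
    qed
    show "\<psi> x \<in> roots_of_unity n" if x: "x \<noteq> 0" for x
    proof -
      obtain i where "x = a ^ i" using a(2)[OF x] by blast
      moreover have "(w ^ i) ^ n = 1" by (metis mult.commute power_mult power_one wn)
      ultimately show ?thesis using w0 unfolding roots_of_unity_def by (simp only: \<psi>) simp
    qed
    show "\<exists>c. c \<noteq> 0 \<and> \<psi> c \<noteq> 1"
      by (rule exI[of _ a]) (use a(1) \<psi>[of 1] w1 in simp)
  qed
qed

section \<open>The bilinear pairing on coordinate vectors\<close>

text \<open>
  The symmetric pairing for which \<open>dual_space\<close> is the orthogonal complement.
\<close>

definition dotp :: "'f::field ^ 'd \<Rightarrow> 'f ^ 'd \<Rightarrow> 'f" where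
  "dotp v w = (\<Sum>i\<in>UNIV. v $ i * w $ i)"

lemma dotp_commute: "dotp v w = dotp w v"
  by (simp add: dotp_def mult.commute)

lemma dotp_add_right: "dotp v (w + w') = dotp v w + dotp v w'"
  by (simp add: dotp_def algebra_simps sum.distrib)

lemma dotp_diff_right: "dotp v (w - w') = dotp v w - dotp v w'"
  by (simp add: dotp_def algebra_simps sum_subtractf)

lemma dotp_scale_right: "dotp v (c *s w) = c * dotp v w"
  by (simp add: dotp_def algebra_simps sum_distrib_left)

lemma dotp_zero_right [simp]: "dotp v 0 = 0"
  by (simp add: dotp_def)

lemma dotp_sum_right: "dotp v (\<Sum>j\<in>J. f j) = (\<Sum>j\<in>J. dotp v (f j))"
  by (induction J rule: infinite_finite_induct) (simp_all add: dotp_add_right)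

lemma dotp_sum_left: "dotp (\<Sum>j\<in>J. f j) v = (\<Sum>j\<in>J. dotp (f j) v)"
  by (simp add: dotp_commute[of _ v] dotp_sum_right)

lemma dotp_scale_left: "dotp (c *s w) v = c * dotp w v"
  by (simp add: dotp_commute[of _ v] dotp_scale_right)

lemma dotp_axis_left: "dotp (axis i 1) v = v $ i"
  by (simp add: dotp_def axis_def if_distrib[of "\<lambda>x. x * _"] cong: if_cong)

lemma dotp_matrix: "dotp (g *v v) w = dotp v (transpose g *v w)"
proof -
  have "dotp (g *v v) w = (\<Sum>i\<in>UNIV. \<Sum>j\<in>UNIV. g $ i $ j * v $ j * w $ i)"
    by (simp add: dotp_def matrix_vector_mult_def sum_distrib_right)
  also have "\<dots> = (\<Sum>j\<in>UNIV. \<Sum>i\<in>UNIV. g $ i $ j * v $ j * w $ i)"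
    by (rule sum.swap)
  also have "\<dots> = dotp v (transpose g *v w)"
    by (simp add: dotp_def matrix_vector_mult_def transpose_def sum_distrib_left mult_ac)
  finally show ?thesis .
qed

lemma invertible_matrix_inv:
  assumes "invertible (g :: 'f::field ^ 'd ^ 'd)"
  shows "g ** matrix_inv g = mat 1" "matrix_inv g ** g = mat 1" "invertible (matrix_inv g)"
proof -
  have "\<exists>h. g ** h = mat 1 \<and> h ** g = mat 1"
    using assms by (simp add: invertible_def)
  hence *: "g ** matrix_inv g = mat 1 \<and> matrix_inv g ** g = mat 1"
    unfolding matrix_inv_def by (rule someI_ex)
  thus "g ** matrix_inv g = mat 1" "matrix_inv g ** g = mat 1" "invertible (matrix_inv g)"
    by (auto simp: invertible_def)
qed

lemma invertible_transpose_inv: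
  assumes "invertible (g :: 'f::field ^ 'd ^ 'd)"
  shows "invertible (transpose (matrix_inv g))"
  using invertible_matrix_inv(3)[OF assms] by (simp add: invertible_det_nz)

lemma matrix_inv_vector:
  assumes "invertible (g :: 'f::field ^ 'd ^ 'd)"
  shows "g *v (matrix_inv g *v v) = v" "matrix_inv g *v (g *v v) = v"
  by (simp_all add: matrix_vector_mul_assoc invertible_matrix_inv[OF assms])

lemma invertible_matrix_vector_eq_0:
  assumes "invertible (g :: 'f::field ^ 'd ^ 'd)" and "g *v v = 0"
  shows "v = 0"
  using matrix_inv_vector(2)[OF assms(1), of v] assms(2) by simp

text \<open>
  The actions on rows and columns are contragredient: this is why a single group element acts on
  both index sets without changing the pairing.
\<close>

lemma dotp_contragredient:
  fixes g :: "'f::field ^ 'd ^ 'd"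
  assumes "invertible g"
  shows "dotp (g *v v) (transpose (matrix_inv g) *v w) = dotp v w"
  unfolding dotp_matrix[of g] matrix_vector_mul_assoc
  by (simp add: invertible_matrix_inv[OF assms] flip: matrix_transpose_mul)

section \<open>Frames of subspaces\<close>

text \<open>
  Bases are indexed by a set \<open>I\<close> of coordinates rather than by numbers, and \<open>v\<close> is arbitrary off
  \<open>I\<close>. Then \<open>k \<times> k\<close> determinants are determinants over the index type \<open>'d\<close>, although \<open>k\<close> is not
  the cardinality of a type.
\<close>

definition frame :: "'d set \<Rightarrow> ('d \<Rightarrow> 'f::field ^ 'd) \<Rightarrow> ('f ^ 'd) set \<Rightarrow> bool" where
  "frame I v x \<longleftrightarrow>
     (\<forall>a. (\<Sum>i\<in>I. a i *s v i) = 0 \<longrightarrow> (\<forall>i\<in>I. a i = 0)) \<and>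
     x = range (\<lambda>a. \<Sum>i\<in>I. a i *s v i)"

lemma frame_mem:
  fixes I :: "'d::finite set"
  assumes "frame I v x" and "i \<in> I"
  shows "v i \<in> x"
proof -
  have "(\<Sum>j\<in>I. (if j = i then 1 else 0) *s v j) = (\<Sum>j\<in>I. if j = i then v j else 0)"
    by (intro sum.cong) auto
  also have "\<dots> = v i" using assms(2) by simp
  finally have "v i = (\<Sum>j\<in>I. (if j = i then 1 else 0) *s v j)" ..
  hence "v i \<in> range (\<lambda>a. \<Sum>j\<in>I. a j *s v j)"
    by (rule range_eqI[where x = "\<lambda>j. if j = i then 1 else 0"])
  thus ?thesis using assms(1) by (simp add: frame_def)
qed

lemma frame_of_basis:
  fixes I :: "'d::finite set"
  assumes "inj_on v I" and "vec.independent (v ` I)"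
  shows "frame I v (vec.span (v ` I))"
  unfolding frame_def
proof
  show "\<forall>a. (\<Sum>i\<in>I. a i *s v i) = 0 \<longrightarrow> (\<forall>i\<in>I. a i = 0)"
  proof (intro allI impI ballI)
    fix a i assume sum: "(\<Sum>i\<in>I. a i *s v i) = 0" and i: "i \<in> I"
    define b where "b z = a (the_inv_into I v z)" for z
    have b: "b (v j) = a j" if "j \<in> I" for j
      using assms(1) that by (simp add: b_def the_inv_into_f_f)
    have "(\<Sum>z\<in>v ` I. b z *s z) = (\<Sum>i\<in>I. a i *s v i)"
      by (simp add: sum.reindex[OF assms(1)] b)
    thus "a i = 0"
      using vec.independentD[OF assms(2), of "v ` I" b "v i"] sum i b by auto
  qed
  show "vec.span (v ` I) = range (\<lambda>a. \<Sum>i\<in>I. a i *s v i)"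
  proof (intro equalityI subsetI)
    fix z assume "z \<in> vec.span (v ` I)"
    then obtain b where "z = (\<Sum>u\<in>v ` I. b u *s u)"
      by (auto simp: vec.span_finite)
    hence "z = (\<Sum>i\<in>I. b (v i) *s v i)"
      by (simp add: sum.reindex[OF assms(1)])
    thus "z \<in> range (\<lambda>a. \<Sum>i\<in>I. a i *s v i)"
      by (rule range_eqI[where x = "\<lambda>i. b (v i)"])
  next
    fix z assume "z \<in> range (\<lambda>a. \<Sum>i\<in>I. a i *s v i)"
    thus "z \<in> vec.span (v ` I)"
      by (auto intro!: vec.span_sum vec.span_scale intro: vec.span_base)
  qed
qed

lemma Gr_has_frame:
  fixes I :: "'d::finite set"
  assumes "x \<in> Gr (card I)"
  shows "\<exists>v. frame I v (x :: ('f::field ^ 'd) set)"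
proof -
  have x: "vec.subspace x" "vec.dim x = card I" using assms by (auto simp: Gr_def)
  obtain B where B: "B \<subseteq> x" "vec.independent B" "x \<subseteq> vec.span B" "card B = vec.dim x"
    by (rule vec.basis_exists)
  have "finite B" using B(2) by (rule vec.finiteI_independent)
  then obtain v where "bij_betw v I B"
    using B(4) x(2) by (metis finite finite_same_card_bij)
  moreover have "vec.span B = x"
    using B x(1) by (metis vec.span_subspace)
  ultimately show ?thesis
    using frame_of_basis[of v I] B(2) by (auto simp: bij_betw_def)
qed

lemma frame_image:
  assumes "invertible g" and "frame I v x"
  shows "frame I (\<lambda>i. g *v v i) (act_X g x)"
proof -
  have lin: "(\<Sum>i\<in>I. a i *s (g *v v i)) = g *v (\<Sum>i\<in>I. a i *s v i)" for a
    by (simp add: vec.sum vec.scale)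
  have "act_X g x = range (\<lambda>a. \<Sum>i\<in>I. a i *s (g *v v i))"
    using assms(2) by (simp add: lin frame_def act_X_def image_image)
  moreover have "\<forall>i\<in>I. a i = 0" if "(\<Sum>i\<in>I. a i *s (g *v v i)) = 0" for a
  proof -
    have "(\<Sum>i\<in>I. a i *s v i) = 0"
      using invertible_matrix_vector_eq_0[OF assms(1)] that by (simp add: lin)
    thus ?thesis using assms(2) by (simp add: frame_def)
  qed
  ultimately show ?thesis by (simp add: frame_def)
qed

section \<open>Gram determinants\<close>

text \<open>
  The \<open>I \<times> I\<close> matrix of pairings, completed by an identity block off \<open>I\<close>; its determinant is
  the determinant of the \<open>I \<times> I\<close> block.
\<close>

definition gram :: "'d set \<Rightarrow> ('d \<Rightarrow> 'f::field ^ 'd) \<Rightarrow> ('d \<Rightarrow> 'f ^ 'd) \<Rightarrow> 'f ^ 'd ^ 'd" where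
  "gram I v w =
     (\<chi> i j. if i \<in> I \<and> j \<in> I then dotp (v i) (w j) else if i = j then 1 else 0)"

definition gram_det :: "'d::finite set \<Rightarrow> ('d \<Rightarrow> 'f::field ^ 'd) \<Rightarrow> ('d \<Rightarrow> 'f ^ 'd) \<Rightarrow> 'f" where
  "gram_det I v w = det (gram I v w)"

lemma gram_det_commute: "gram_det I v w = gram_det I w v"
proof -
  have "gram I v w = transpose (gram I w v)"
    by (auto simp: gram_def transpose_def vec_eq_iff dotp_commute)
  thus ?thesis by (simp add: gram_det_def)
qed

lemma gram_det_contragredient:
  assumes "invertible g"
  shows "gram_det I (\<lambda>i. g *v v i) (\<lambda>i. transpose (matrix_inv g) *v w i) = gram_det I v w"
  unfolding gram_det_def gram_def dotp_contragredient[OF assms] ..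

text \<open>
  The coefficients \<open>h\<close>, completed by an identity block off \<open>I\<close>, form a matrix whose product with
  the old Gram matrix is the new one. Its determinant is the factor, the same for all \<open>w\<close>.
\<close>

lemma gram_det_base_change:
  fixes I :: "'d::finite set" and v v' :: "'d \<Rightarrow> 'f::field ^ 'd"
  assumes "\<And>i. i \<in> I \<Longrightarrow> v' i = (\<Sum>j\<in>I. h i j *s v j)"
  shows "\<exists>c. \<forall>w. gram_det I v' w = c * gram_det I v w"
proof -
  define H :: "'f ^ 'd ^ 'd" where
    "H = (\<chi> i j. if i \<in> I \<and> j \<in> I then h i j else if i = j then 1 else 0)"
  have "gram I v' w = H ** gram I v w" for w
  proof (intro vec_eq_iff[THEN iffD2] allI)
    fix i m
    have rhs: "(H ** gram I v w) $ i $ m = (\<Sum>j\<in>UNIV. H $ i $ j * gram I v w $ j $ m)"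
      by (simp add: matrix_matrix_mult_def)
    show "gram I v' w $ i $ m = (H ** gram I v w) $ i $ m"
    proof (cases "i \<in> I")
      case True
      have "(\<Sum>j\<in>UNIV. H $ i $ j * gram I v w $ j $ m) =
            (\<Sum>j\<in>I. H $ i $ j * gram I v w $ j $ m)"
        by (rule sum.mono_neutral_right) (use True in \<open>auto simp: H_def\<close>)
      also have "\<dots> = (\<Sum>j\<in>I. if m \<in> I then h i j * dotp (v j) (w m) else 0)"
        by (rule sum.cong) (use True in \<open>auto simp: H_def gram_def\<close>)
      also have "\<dots> = gram I v' w $ i $ m"
        using True by (auto simp: gram_def assms dotp_sum_left dotp_scale_left)
      finally show ?thesis using rhs by simp
    next
      case False
      have "(\<Sum>j\<in>UNIV. H $ i $ j * gram I v w $ j $ m) =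
            (\<Sum>j\<in>UNIV. if j = i then gram I v w $ j $ m else 0)"
        by (rule sum.cong) (use False in \<open>auto simp: H_def\<close>)
      also have "\<dots> = gram I v' w $ i $ m"
        using False by (simp add: gram_def)
      finally show ?thesis using rhs by simp
    qed
  qed
  hence "gram_det I v' w = det H * gram_det I v w" for w
    by (simp add: gram_det_def det_mul)
  thus ?thesis by blast
qed

text \<open>
  Base change in both directions gives factors \<open>c\<close> and \<open>c'\<close>. If \<open>c = 0\<close>, then both determinants
  vanish for all \<open>w\<close>, and any nonzero factor will do.
\<close>

lemma gram_det_frame_change:
  fixes I :: "'d::finite set" and v v' :: "'d \<Rightarrow> 'f::field ^ 'd"
  assumes "frame I v x" and "frame I v' x"
  shows "\<exists>c. c \<noteq> 0 \<and> (\<forall>w. gram_det I v' w = c * gram_det I v w)"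
proof -
  have change: "\<exists>c. \<forall>w. gram_det I v2 w = c * gram_det I v1 w"
    if "frame I v1 x" "frame I v2 x" for v1 v2 :: "'d \<Rightarrow> 'f ^ 'd"
  proof -
    have "\<forall>i\<in>I. \<exists>a. v2 i = (\<Sum>j\<in>I. a j *s v1 j)"
      using frame_mem[OF that(2)] that(1) by (auto simp: frame_def)
    then obtain h where "\<And>i. i \<in> I \<Longrightarrow> v2 i = (\<Sum>j\<in>I. h i j *s v1 j)"
      by metis
    thus ?thesis by (rule gram_det_base_change)
  qed
  obtain c where c: "\<And>w. gram_det I v' w = c * gram_det I v w"
    using change[OF assms] by blast
  obtain c' where c': "\<And>w. gram_det I v w = c' * gram_det I v' w"
    using change[OF assms(2,1)] by blast
  show ?thesis
  proof (cases "c = 0")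
    case False
    with c show ?thesis by blast
  next
    case True
    hence "gram_det I v' w = 0 \<and> gram_det I v w = 0" for w
      using c[of w] c'[of w] by simp
    thus ?thesis by (intro exI[of _ 1]) simp
  qed
qed

lemma frame_dual_space:
  fixes I :: "'d::finite set"
  assumes "frame I w y"
  shows "u \<in> dual_space y \<longleftrightarrow> (\<forall>i\<in>I. dotp (w i) u = 0)"
proof
  assume "u \<in> dual_space y"
  thus "\<forall>i\<in>I. dotp (w i) u = 0"
    using frame_mem[OF assms] by (auto simp: dual_space_def dotp_def)
next
  assume *: "\<forall>i\<in>I. dotp (w i) u = 0"
  have "dotp z u = 0" if "z \<in> y" for z
    using that assms * by (auto simp: frame_def dotp_sum_left dotp_scale_left)
  thus "u \<in> dual_space y" by (simp add: dual_space_def dotp_def)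
qed

lemma gram_vector:
  fixes I :: "'d::finite set"
  shows "(gram I w v *v a) $ i =
    (if i \<in> I then dotp (w i) (\<Sum>j\<in>I. a $ j *s v j) else a $ i)"
proof (cases "i \<in> I")
  case True
  have "(gram I w v *v a) $ i = (\<Sum>j\<in>UNIV. gram I w v $ i $ j * a $ j)"
    by (simp add: matrix_vector_mult_def)
  also have "\<dots> = (\<Sum>j\<in>I. gram I w v $ i $ j * a $ j)"
    by (rule sum.mono_neutral_right) (use True in \<open>auto simp: gram_def\<close>)
  also have "\<dots> = dotp (w i) (\<Sum>j\<in>I. a $ j *s v j)"
    using True by (simp add: gram_def dotp_sum_right dotp_scale_right mult.commute)
  finally show ?thesis using True by simp
next
  case False
  have "(gram I w v *v a) $ i = (\<Sum>j\<in>UNIV. if j = i then a $ j else 0)"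
    unfolding matrix_vector_mult_def vec_lambda_beta
    by (rule sum.cong) (use False in \<open>auto simp: gram_def\<close>)
  thus ?thesis using False by simp
qed

text \<open>
  The coordinate vectors in the kernel of the Gram matrix are the coordinates of the vectors of \<open>x\<close>
  that are orthogonal to \<open>y\<close>.
\<close>

lemma gram_det_nonzero_iff:
  fixes I :: "'d::finite set"
  assumes v: "frame I v x" and w: "frame I w y"
  shows "gram_det I v w \<noteq> 0 \<longleftrightarrow> x \<inter> dual_space y = {0}"
proof -
  have "gram_det I v w \<noteq> 0 \<longleftrightarrow> det (gram I w v) \<noteq> 0"
    by (metis gram_det_commute gram_det_def)
  also have "\<dots> \<longleftrightarrow> (\<forall>a. gram I w v *v a = 0 \<longrightarrow> a = 0)"
    unfolding invertible_det_nz[symmetric] invertible_left_inverse matrix_left_invertible_ker ..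
  also have "\<dots> \<longleftrightarrow> (\<forall>u\<in>x \<inter> dual_space y. u = 0)"
  proof safe
    fix u assume ker: "\<forall>a. gram I w v *v a = 0 \<longrightarrow> a = 0" and u: "u \<in> x" "u \<in> dual_space y"
    obtain a where a: "u = (\<Sum>i\<in>I. a i *s v i)"
      using v u(1) by (auto simp: frame_def)
    define b where "b = (\<chi> i. if i \<in> I then a i else 0)"
    have b: "u = (\<Sum>i\<in>I. b $ i *s v i)" unfolding a b_def by (intro sum.cong) auto
    have "gram I w v *v b = 0"
      using u(2) by (auto simp: vec_eq_iff gram_vector frame_dual_space[OF w] simp flip: b)
        (simp add: b_def)
    hence "b = 0" using ker by blast
    thus "u = 0" unfolding b by simp
  next
    fix a assume *: "\<forall>u\<in>x \<inter> dual_space y. u = 0" and a: "gram I w v *v a = 0"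
    define u where "u = (\<Sum>j\<in>I. a $ j *s v j)"
    have 1: "(if i \<in> I then dotp (w i) u else a $ i) = 0" for i
      using a unfolding vec_eq_iff gram_vector u_def by simp
    have "u \<in> dual_space y" unfolding frame_dual_space[OF w] using 1 by presburger
    moreover have "u \<in> x" using v by (auto simp: frame_def u_def)
    ultimately have "u = 0" using * by blast
    hence "\<forall>i\<in>I. a $ i = 0" using v unfolding u_def frame_def by blast
    with 1 show "a = 0" by (metis vec_eq_iff zero_index)
  qed
  also have "\<dots> \<longleftrightarrow> x \<inter> dual_space y = {0}"
  proof -
    have "0 \<in> x" using v by (auto simp: frame_def intro!: image_eqI[of _ _ "\<lambda>_. 0"])
    moreover have "0 \<in> dual_space y" by (simp add: dual_space_def)
    ultimately show ?thesis by blast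
  qed
  finally show ?thesis .
qed

section \<open>The Grassmannian and duality\<close>

lemma Gr_D:
  assumes "x \<in> Gr k"
  shows "vec.subspace x" "vec.dim x = k"
  using assms by (auto simp: Gr_def)

lemma act_X_Gr:
  assumes "invertible g" and "x \<in> Gr k"
  shows "act_X g x \<in> Gr k"
proof -
  have "inj ((*v) g)"
    using matrix_inv_vector(2)[OF assms(1)] by (metis injI)
  hence "vec.dim (act_X g x) = vec.dim x"
    unfolding act_X_def by (intro vec.dim_image_eq matrix_vector_mul_linear_gen) (rule inj_on_subset, auto)
  moreover have "vec.subspace (act_X g x)"
    unfolding act_X_def by (rule vec.subspace_image[OF Gr_D(1)[OF assms(2)]])
  ultimately show ?thesis using assms(2) by (simp add: Gr_def)
qed

lemma act_X_inverse:
  assumes "invertible g"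
  shows "act_X (matrix_inv g) (act_X g x) = x" "act_X g (act_X (matrix_inv g) x) = x"
  by (simp_all add: act_X_def image_image matrix_inv_vector[OF assms])

lemma bij_betw_act_X:
  assumes "invertible g"
  shows "bij_betw (act_X g) (Gr k) (Gr k)"
  by (rule bij_betwI[where g = "act_X (matrix_inv g)"])
    (auto simp: act_X_Gr assms invertible_matrix_inv[OF assms] act_X_inverse[OF assms])

lemma act_Y_eq_act_X: "act_Y g = act_X (transpose (matrix_inv g))"
  by (simp add: fun_eq_iff act_X_def act_Y_def)

lemma dual_space_act_Y:
  fixes g :: "'f::field ^ 'd ^ 'd"
  assumes "invertible g"
  shows "dual_space (act_Y g y) = act_X g (dual_space y)"
proof (intro equalityI subsetI)
  fix z assume z: "z \<in> dual_space (act_Y g y)"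
  have "dotp w (matrix_inv g *v z) = 0" if "w \<in> y" for w
  proof -
    have "dotp (transpose (matrix_inv g) *v w) z = 0"
      using z that unfolding dual_space_def act_Y_def dotp_def by blast
    thus ?thesis unfolding dotp_matrix by simp
  qed
  hence "matrix_inv g *v z \<in> dual_space y" by (simp add: dual_space_def dotp_def)
  hence "g *v (matrix_inv g *v z) \<in> act_X g (dual_space y)" unfolding act_X_def by (rule imageI)
  thus "z \<in> act_X g (dual_space y)" by (simp only: matrix_inv_vector[OF assms])
next
  fix z assume "z \<in> act_X g (dual_space y)"
  then obtain u where u: "z = g *v u" "u \<in> dual_space y" by (auto simp: act_X_def)
  have "dotp (transpose (matrix_inv g) *v w) z = 0" if "w \<in> y" for w
    unfolding u(1) dotp_commute[of _ "g *v u"] dotp_contragredient[OF assms]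
    unfolding dotp_commute[of u] using u(2) that by (simp add: dual_space_def dotp_def)
  thus "z \<in> dual_space (act_Y g y)" unfolding act_Y_def dual_space_def dotp_def by blast
qed

lemma frame_independent:
  fixes I :: "'d::finite set"
  assumes "frame I v x"
  shows "inj_on v I" "vec.independent (v ` I)" "vec.span (v ` I) = x"
proof -
  have coeff: "\<forall>i\<in>I. a i = 0" if "(\<Sum>i\<in>I. a i *s v i) = 0" for a
    using assms that by (auto simp: frame_def)
  show inj: "inj_on v I"
  proof (rule inj_onI, rule ccontr)
    fix i j assume ij: "i \<in> I" "j \<in> I" "v i = v j" "i \<noteq> j"
    have "(\<Sum>l\<in>I. (of_bool (l = i) - of_bool (l = j)) *s v l) = (\<Sum>l\<in>I. (if l = i then v l else 0) - (if l = j then v l else 0))"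
      by (intro sum.cong) auto
    also have "\<dots> = 0" using ij by (simp add: sum_subtractf)
    finally show False using coeff ij by fastforce
  qed
  show indep: "vec.independent (v ` I)"
    unfolding vec.independent_explicit_module
  proof (intro allI impI)
    fix t b z assume t: "finite t" "t \<subseteq> v ` I" "(\<Sum>z\<in>t. b z *s z) = 0" "z \<in> t"
    define b' where "b' z = (if z \<in> t then b z else 0)" for z
    have "(\<Sum>i\<in>I. b' (v i) *s v i) = (\<Sum>z\<in>v ` I. b' z *s z)"
      by (simp add: sum.reindex[OF inj])
    also have "\<dots> = (\<Sum>z\<in>t. b z *s z)"
      using t(2) by (intro sum.mono_neutral_cong_right) (auto simp: b'_def)
    finally have "\<forall>i\<in>I. b' (v i) = 0" using coeff t(3) by simp
    moreover obtain i where "i \<in> I" "z = v i" using t(2,4) by blast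
    ultimately show "b z = 0" using t(4) by (auto simp: b'_def)
  qed
  show "vec.span (v ` I) = x"
    using frame_of_basis[OF inj indep] assms by (simp add: frame_def)
qed

text \<open>
  Extend the frame to a basis of the whole space and use the basis as the rows of \<open>g\<close>.
\<close>

lemma frame_extends_to_invertible:
  fixes I :: "'d::finite set" and v :: "'d \<Rightarrow> 'f::field ^ 'd"
  assumes "frame I v x"
  shows "\<exists>g. invertible g \<and> (\<forall>i\<in>I. g $ i = v i)"
proof -
  note v = frame_independent[OF assms]
  define B where "B = vec.extend_basis (v ` I)"
  have B: "v ` I \<subseteq> B" "vec.independent B" "vec.span B = UNIV"
    unfolding B_def by (simp_all add: vec.extend_basis_superset vec.independent_extend_basis
      vec.span_extend_basis v(2))
  have finB: "finite B" using B(2) by (rule vec.finiteI_independent)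
  have "card B = CARD('d)"
    using vec.dim_eq_card_independent[OF B(2)] vec.dim_span[of B] B(3) vec_dim_card by metis
  hence "card (B - v ` I) = card (- I)"
    using card_Diff_subset[OF _ B(1)] by (simp add: card_image[OF v(1)] Compl_eq_Diff_UNIV card_Diff_subset)
  then obtain h where h: "bij_betw h (- I) (B - v ` I)"
    using finB by (metis finite_same_card_bij finite finite_Diff)
  define g :: "'f ^ 'd ^ 'd" where "g = (\<chi> i. if i \<in> I then v i else h i)"
  have "rows g = B"
  proof -
    have "rows g = v ` I \<union> h ` (- I)" by (auto simp: rows_def row_def g_def)
    thus ?thesis using h B(1) by (auto simp: bij_betw_def)
  qed
  hence "invertible g"
    unfolding invertible_left_inverse matrix_left_invertible_span_rows_gen by (simp add: B(3))
  thus ?thesis by (auto simp: g_def)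
qed

lemma subspace_dual_space: "vec.subspace (dual_space x)"
proof -
  have "dual_space x = {z. \<forall>v\<in>x. dotp v z = 0}" by (simp add: dual_space_def dotp_def)
  thus ?thesis
    by (auto intro!: vec.subspaceI simp: dotp_add_right dotp_scale_right)
qed

text \<open>
  An invertible matrix whose rows at \<open>I\<close> form a frame of \<open>x\<close> maps \<open>dual_space x\<close> onto the
  coordinate space where the coordinates in \<open>I\<close> vanish.
\<close>

lemma dual_space_Gr:
  fixes x :: "('f::field ^ 'd) set"
  assumes "x \<in> Gr k"
  shows "dual_space x \<in> Gr (CARD('d) - k)"
proof -
  have "k \<le> CARD('d)" using dim_subset_UNIV_cart_gen[of x] Gr_D[OF assms] by simp
  then obtain I :: "'d set" where I: "card I = k"
    by (metis obtain_subset_with_card_n)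
  obtain v where v: "frame I v x" using Gr_has_frame assms I by blast
  obtain g where g: "invertible g" "\<forall>i\<in>I. g $ i = v i"
    using frame_extends_to_invertible[OF v] by blast
  define E where "E = {z :: 'f ^ 'd. \<forall>i. i \<notin> - I \<longrightarrow> z $ i = 0}"
  have E: "E \<in> Gr (CARD('d) - k)"
    using dim_substandard_cart[where 'a = 'f, of "- I"]
    by (auto simp: Gr_def E_def Compl_eq_Diff_UNIV card_Diff_subset I intro!: vec.subspaceI)
  have mem: "z \<in> dual_space x \<longleftrightarrow> g *v z \<in> E" for z
  proof -
    have "(g *v z) $ i = dotp (g $ i) z" for i
      by (simp add: matrix_vector_mult_def dotp_def)
    thus ?thesis using g(2) by (auto simp: frame_dual_space[OF v] E_def)
  qed
  have "dual_space x = act_X (matrix_inv g) E"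
  proof (intro equalityI subsetI)
    fix z assume "z \<in> dual_space x"
    hence "matrix_inv g *v (g *v z) \<in> act_X (matrix_inv g) E"
      unfolding act_X_def mem by (rule imageI)
    thus "z \<in> act_X (matrix_inv g) E" by (simp only: matrix_inv_vector[OF g(1)])
  qed (auto simp: act_X_def mem matrix_inv_vector[OF g(1)])
  thus ?thesis using act_X_Gr[OF invertible_matrix_inv(3)[OF g(1)] E] by simp
qed

lemma dual_space_dual_space:
  assumes "x \<in> Gr k"
  shows "dual_space (dual_space x) = (x :: ('f::field ^ 'd) set)"
proof (rule vec.subspace_dim_equal[symmetric])
  have "k \<le> CARD('d)" using dim_subset_UNIV_cart_gen[of x] Gr_D[OF assms] by simp
  thus "vec.dim (dual_space (dual_space x)) \<le> vec.dim x"
    using Gr_D[OF dual_space_Gr[OF dual_space_Gr[OF assms]]] Gr_D[OF assms] by simp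
  show "x \<subseteq> dual_space (dual_space x)"
    by (auto simp: dual_space_def mult.commute)
qed (use Gr_D[OF assms] subspace_dual_space in auto)

section \<open>Counting subspaces\<close>

text \<open>
  A basis identifies the subspace with the functions from the basis to the field.
\<close>

lemma card_subspace:
  fixes V :: "('f::{field,finite} ^ 'd::finite) set"
  assumes "vec.subspace V"
  shows "card V = CARD('f) ^ vec.dim V"
proof -
  obtain B where B: "B \<subseteq> V" "vec.independent B" "V \<subseteq> vec.span B" "card B = vec.dim V"
    by (rule vec.basis_exists)
  have V: "V = vec.span B" using B assms by (metis vec.span_subspace)
  define f where "f = (\<lambda>a. \<Sum>z\<in>B. a z *s z)"
  have inj: "inj_on f (PiE B (\<lambda>_. UNIV))"
  proof (rule inj_onI)
    fix a b assume ab: "a \<in> PiE B (\<lambda>_. UNIV)" "b \<in> PiE B (\<lambda>_. UNIV)" "f a = f b"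
    have "(\<Sum>z\<in>B. (a z - b z) *s z) = 0"
      using ab(3) by (simp add: f_def vec.scale_left_diff_distrib sum_subtractf)
    hence "a z = b z" if "z \<in> B" for z
      using vec.independentD[OF B(2) _ subset_refl _ that, of "\<lambda>z. a z - b z"] by simp
    thus "a = b" using ab(1,2) by (auto intro: PiE_ext)
  qed
  have "V = f ` PiE B (\<lambda>_. UNIV)"
  proof (intro equalityI subsetI)
    fix z assume "z \<in> V"
    then obtain a where "z = (\<Sum>u\<in>B. a u *s u)" unfolding V by (auto simp: vec.span_finite)
    hence "z = f (restrict a B)" by (simp add: f_def)
    thus "z \<in> f ` PiE B (\<lambda>_. UNIV)" by (rule image_eqI[where x = "restrict a B"]) simp
  next
    fix z assume "z \<in> f ` PiE B (\<lambda>_. UNIV)"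
    thus "z \<in> V" unfolding V f_def
      by (auto intro!: vec.span_sum vec.span_scale intro: vec.span_base)
  qed
  hence "card V = card (PiE B (\<lambda>_. UNIV :: 'f set))" using card_image[OF inj] by simp
  thus ?thesis by (simp add: card_PiE B(4))
qed

text \<open>
  For a subspace \<open>Z\<close>: the classes of the listed vectors modulo \<open>Z\<close> are linearly independent.
\<close>

fun indep_mod :: "('f::field ^ 'd) set \<Rightarrow> ('f ^ 'd) list \<Rightarrow> bool" where
  "indep_mod Z [] \<longleftrightarrow> True"
| "indep_mod Z (v # vs) \<longleftrightarrow> v \<notin> vec.span (Z \<union> set vs) \<and> indep_mod Z vs"

lemma dim_indep_mod:
  "indep_mod Z vs \<Longrightarrow> vec.dim (Z \<union> set vs) = vec.dim Z + length vs"
  by (induction vs) (auto simp: vec.dim_insert)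

text \<open>
  Each new vector may be anything outside the span of \<open>Z\<close> and the earlier vectors, and that span
  has dimension \<open>vec.dim Z\<close> plus the number of earlier vectors.
\<close>

lemma card_indep_mod:
  fixes Z V :: "('f::{field,finite} ^ 'd::finite) set"
  assumes "vec.subspace Z" and V: "vec.subspace V" and "Z \<subseteq> V"
  shows "finite {vs. length vs = m \<and> set vs \<subseteq> V \<and> indep_mod Z vs} \<and>
    card {vs. length vs = m \<and> set vs \<subseteq> V \<and> indep_mod Z vs} =
      (\<Prod>i<m. CARD('f) ^ vec.dim V - CARD('f) ^ (vec.dim Z + i))"
proof (induction m)
  case 0
  have "{vs. length vs = 0 \<and> set vs \<subseteq> V \<and> indep_mod Z vs} = {[]}" by auto
  thus ?case by simp
next
  case (Suc m)
  define L where "L m = {vs. length vs = m \<and> set vs \<subseteq> V \<and> indep_mod Z vs}" for m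
  let ?S = "SIGMA vs:L m. V - vec.span (Z \<union> set vs)"
  have fibre: "card (V - vec.span (Z \<union> set vs)) =
      CARD('f) ^ vec.dim V - CARD('f) ^ (vec.dim Z + m)" if "vs \<in> L m" for vs
  proof -
    have "vec.span (Z \<union> set vs) \<subseteq> V"
      using that assms by (intro vec.span_minimal) (auto simp: L_def)
    thus ?thesis
      using that dim_indep_mod[of Z vs] vec.dim_span[of "Z \<union> set vs"]
      by (simp add: card_Diff_subset card_subspace V L_def)
  qed
  have L: "L (Suc m) = (\<lambda>(vs, v). v # vs) ` ?S"
  proof (intro equalityI subsetI)
    fix ws assume "ws \<in> L (Suc m)"
    then obtain v vs where "ws = v # vs" "(vs, v) \<in> ?S"
      by (cases ws) (auto simp: L_def)
    thus "ws \<in> (\<lambda>(vs, v). v # vs) ` ?S" by force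
  qed (auto simp: L_def)
  have fin: "finite (L m)" using Suc by (simp add: L_def)
  have "card (L (Suc m)) = card ?S"
    unfolding L by (rule card_image) (auto intro!: inj_onI)
  also have "\<dots> = (\<Sum>vs\<in>L m. CARD('f) ^ vec.dim V - CARD('f) ^ (vec.dim Z + m))"
    using fin by (subst card_SigmaI) (auto simp: fibre)
  also have "\<dots> = card (L m) * (CARD('f) ^ vec.dim V - CARD('f) ^ (vec.dim Z + m))"
    by simp
  finally have "card (L (Suc m)) = card (L m) * (CARD('f) ^ vec.dim V - CARD('f) ^ (vec.dim Z + m))" .
  moreover have "finite (L (Suc m))" unfolding L using fin by simp
  ultimately show ?case using Suc by (simp add: L_def)
qed

text \<open>
  This sorts the lists that are independent modulo \<open>Z\<close> by the spaces that they span.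
\<close>

lemma indep_mod_iff_trivial_intersection:
  assumes "vec.subspace Z"
  shows "indep_mod Z vs \<longleftrightarrow> indep_mod {0} vs \<and> vec.span (set vs) \<inter> Z = {0}"
proof (induction vs)
  case Nil
  show ?case using vec.subspace_0[OF assms] by auto
next
  case (Cons v vs)
  let ?Y = "vec.span (set vs)"
  have span0: "vec.span ({0} \<union> set vs) = ?Y" by simp
  have spanZ: "w \<in> vec.span (Z \<union> set vs) \<longleftrightarrow> (\<exists>z\<in>Z. w - z \<in> ?Y)" for w
  proof -
    have spanZ: "vec.span Z = Z" using assms by (simp only: vec.span_eq_iff)
    have "w \<in> vec.span (Z \<union> set vs) \<longleftrightarrow> (\<exists>z\<in>Z. \<exists>y\<in>?Y. w = z + y)"
      unfolding vec.span_Un spanZ by auto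
    also have "\<dots> \<longleftrightarrow> (\<exists>z\<in>Z. w - z \<in> ?Y)"
      by (metis add_diff_cancel_left' diff_add_cancel add.commute)
    finally show ?thesis .
  qed
  have Z0: "0 \<in> Z" using assms by (rule vec.subspace_0)
  show ?case
  proof
    assume L: "indep_mod Z (v # vs)"
    hence v: "v \<notin> vec.span (Z \<union> set vs)" and vs: "indep_mod {0} vs" "?Y \<inter> Z = {0}"
      using Cons.IH by auto
    have "v \<notin> ?Y" using v Z0 spanZ[of v] by (metis diff_zero)
    have "u = 0" if u: "u \<in> vec.span (set (v # vs))" "u \<in> Z" for u
    proof -
      obtain c where c: "u - c *s v \<in> ?Y" using u(1) by (auto simp: vec.span_breakdown_eq)
      have "c = 0"
      proof (rule ccontr)
        assume "c \<noteq> 0"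
        have "(- inverse c) *s (u - c *s v) \<in> ?Y" using c by (rule vec.span_scale)
        moreover have "(- inverse c) *s (u - c *s v) = v - inverse c *s u"
          using \<open>c \<noteq> 0\<close> by (simp add: vec_eq_iff field_simps)
        ultimately have "v - inverse c *s u \<in> ?Y" by simp
        moreover have "inverse c *s u \<in> Z" by (rule vec.subspace_scale[OF assms u(2)])
        ultimately show False using v spanZ[of v] by blast
      qed
      hence "u \<in> ?Y \<inter> Z" using c u(2) by simp
      thus "u = 0" using vs(2) by simp
    qed
    hence "vec.span (set (v # vs)) \<inter> Z = {0}"
      using Z0 vec.span_zero[of "set (v # vs)"] by blast
    moreover have "indep_mod {0} (v # vs)"
      using \<open>v \<notin> ?Y\<close> vs(1) by (simp only: indep_mod.simps span0 simp_thms)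
    ultimately show "indep_mod {0} (v # vs) \<and> vec.span (set (v # vs)) \<inter> Z = {0}" by simp
  next
    assume R: "indep_mod {0} (v # vs) \<and> vec.span (set (v # vs)) \<inter> Z = {0}"
    have "?Y \<subseteq> vec.span (set (v # vs))" by (rule vec.span_mono) auto
    hence "?Y \<inter> Z = {0}" using R Z0 vec.span_zero[of "set vs"] by blast
    moreover have "v \<notin> vec.span (Z \<union> set vs)"
    proof
      assume "v \<in> vec.span (Z \<union> set vs)"
      then obtain z where z: "z \<in> Z" "v - z \<in> ?Y" unfolding spanZ by blast
      have "v - (v - z) \<in> vec.span (set (v # vs))"
        by (rule vec.span_diff) (use z(2) \<open>?Y \<subseteq> _\<close> in \<open>auto intro: vec.span_base\<close>)
      hence "z \<in> vec.span (set (v # vs)) \<inter> Z" using z(1) by simp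
      hence "z = 0" using R by (simp only: singleton_iff)
      hence "v \<in> ?Y" using z(2) by simp
      moreover have "v \<notin> ?Y" using R by (simp only: indep_mod.simps span0 simp_thms)
      ultimately show False by simp
    qed
    ultimately show "indep_mod Z (v # vs)" using R Cons.IH by simp
  qed
qed

text \<open>
  The lists of \<open>k\<close> vectors that are independent modulo \<open>Z\<close> are the ordered bases of the counted
  spaces, and each of these spaces has \<open>\<Prod>i<k. (q ^ k - q ^ i)\<close> ordered bases.
\<close>

lemma card_Gr_complementary:
  fixes Z :: "('f::{field,finite} ^ 'd::finite) set"
  assumes Z: "vec.subspace Z"
  shows "card {y \<in> Gr k. y \<inter> Z = {0}} * (\<Prod>i<k. CARD('f) ^ k - CARD('f) ^ i) =
    (\<Prod>i<k. CARD('f) ^ CARD('d) - CARD('f) ^ (vec.dim Z + i))"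
proof -
  let ?Y = "{y \<in> Gr k. y \<inter> Z = {0}}"
  define F where "F y = {vs. length vs = k \<and> set vs \<subseteq> y \<and> indep_mod {0} vs}" for y :: "('f ^ 'd) set"
  have zero: "vec.subspace {0 :: 'f ^ 'd}" by (rule vec.subspace_single_0)
  have F: "finite (F y)" "card (F y) = (\<Prod>i<k. CARD('f) ^ k - CARD('f) ^ i)" if "y \<in> Gr k" for y
  proof -
    have "{0} \<subseteq> y" using vec.subspace_0[OF Gr_D(1)[OF that]] by simp
    from card_indep_mod[OF zero Gr_D(1)[OF that] this, of k]
    show "finite (F y)" "card (F y) = (\<Prod>i<k. CARD('f) ^ k - CARD('f) ^ i)"
      using Gr_D(2)[OF that] by (simp_all add: F_def)
  qed
  have span: "vec.span (set vs) = y" if "y \<in> Gr k" "vs \<in> F y" for y vs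
  proof (rule vec.subspace_dim_equal)
    show "vec.span (set vs) \<subseteq> y"
      using that by (intro vec.span_minimal) (auto simp: F_def Gr_D)
    show "vec.dim y \<le> vec.dim (vec.span (set vs))"
      using that dim_indep_mod[of "{0}" vs] by (simp add: F_def Gr_D vec.dim_insert vec.span_zero)
  qed (use that Gr_D in auto)
  have spanGr: "vec.span (set vs) \<in> Gr k" if "length vs = k" "indep_mod {0} vs" for vs :: "('f ^ 'd) list"
    using that dim_indep_mod[of "{0}" vs] by (simp add: Gr_def vec.dim_insert vec.span_zero)
  have "(\<Union>y\<in>?Y. F y) = {vs. length vs = k \<and> set vs \<subseteq> UNIV \<and> indep_mod Z vs}"
  proof (intro equalityI subsetI)
    fix vs assume "vs \<in> (\<Union>y\<in>?Y. F y)"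
    then obtain y where y: "y \<in> Gr k" "y \<inter> Z = {0}" "vs \<in> F y" by blast
    with span[OF y(1,3)] show "vs \<in> {vs. length vs = k \<and> set vs \<subseteq> UNIV \<and> indep_mod Z vs}"
      by (auto simp: F_def indep_mod_iff_trivial_intersection[OF Z])
  next
    fix vs assume "vs \<in> {vs. length vs = k \<and> set vs \<subseteq> UNIV \<and> indep_mod Z vs}"
    hence vs: "length vs = k" "indep_mod {0} vs" "vec.span (set vs) \<inter> Z = {0}"
      by (auto simp: indep_mod_iff_trivial_intersection[OF Z])
    have "vec.span (set vs) \<in> ?Y" using spanGr[OF vs(1,2)] vs(3) by simp
    moreover have "vs \<in> F (vec.span (set vs))" using vs by (auto simp: F_def intro: vec.span_base)
    ultimately show "vs \<in> (\<Union>y\<in>?Y. F y)" by (rule UN_I)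
  qed
  moreover have "card (\<Union>y\<in>?Y. F y) = (\<Sum>y\<in>?Y. card (F y))"
  proof (rule card_UN_disjoint)
    show "\<forall>y\<in>?Y. \<forall>y'\<in>?Y. y \<noteq> y' \<longrightarrow> F y \<inter> F y' = {}"
    proof (intro ballI impI)
      fix y y' assume yy: "y \<in> ?Y" "y' \<in> ?Y" "y \<noteq> y'"
      hence "vs \<notin> F y'" if "vs \<in> F y" for vs
        using span[of y vs] span[of y' vs] that by auto
      thus "F y \<inter> F y' = {}" by blast
    qed
  qed (use F(1) in auto)
  moreover have "(\<Sum>y\<in>?Y. card (F y)) = card ?Y * (\<Prod>i<k. CARD('f) ^ k - CARD('f) ^ i)"
    using F(2) by simp
  ultimately show ?thesis
    using card_indep_mod[OF Z vec.subspace_UNIV, of k] by (simp add: card_cart_basis)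
qed

lemma card_field_gt_1: "1 < CARD('f::{field,finite})"
proof -
  have "card {0, 1 :: 'f} \<le> CARD('f)" by (rule card_mono) auto
  thus ?thesis by simp
qed

lemma frame_count_pos: "1 < (q :: nat) \<Longrightarrow> (\<Prod>i<k. q ^ k - q ^ i) > 0"
  by (rule prod_pos) (auto intro: power_strict_increasing)

text \<open>
  In the count of ordered bases, \<open>dual_space x\<close> has dimension \<open>d - k\<close>, and taking \<open>q ^ (d - k)\<close> out
  of each of the \<open>k\<close> factors leaves the number of ordered bases of a \<open>k\<close>-dimensional space.
\<close>

lemma card_Gr_transverse:
  fixes x :: "('f::{field,finite} ^ 'd::finite) set"
  assumes "x \<in> Gr k" and "k \<le> CARD('d)"
  shows "card {y \<in> Gr k. y \<inter> dual_space x = {0}} = CARD('f) ^ (k * (CARD('d) - k))"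
proof -
  let ?q = "CARD('f)"
  have "(\<Prod>i<k. ?q ^ CARD('d) - ?q ^ (CARD('d) - k + i)) =
        (\<Prod>i<k. ?q ^ (CARD('d) - k) * (?q ^ k - ?q ^ i))"
    using assms(2) by (intro prod.cong) (auto simp: diff_mult_distrib2 simp flip: power_add)
  also have "\<dots> = ?q ^ (k * (CARD('d) - k)) * (\<Prod>i<k. ?q ^ k - ?q ^ i)"
    by (simp add: prod.distrib mult.commute flip: power_mult)
  finally have "card {y \<in> Gr k. y \<inter> dual_space x = {0}} * (\<Prod>i<k. ?q ^ k - ?q ^ i) =
      ?q ^ (k * (CARD('d) - k)) * (\<Prod>i<k. ?q ^ k - ?q ^ i)"
    using card_Gr_complementary[OF subspace_dual_space[of x], of k]
    by (simp only: Gr_D(2)[OF dual_space_Gr[OF assms(1)]])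
  thus ?thesis
    using frame_count_pos[OF card_field_gt_1[where 'f = 'f], of k]
    by (simp only: mult_cancel2) linarith
qed

lemma card_Gr_gaussian_binomial:
  assumes "k \<le> CARD('d)"
  shows "real (card (Gr k :: ('f::{field,finite} ^ 'd::finite) set set)) =
    gaussian_binomial CARD('f) CARD('d) k"
proof -
  define q d where "q = CARD('f)" and "d = CARD('d)"
  have q: "1 < q" unfolding q_def by (rule card_field_gt_1)
  have kd: "k \<le> d" using assms by (simp add: d_def)
  let ?P = "\<lambda>n. (\<Prod>i = 1..n. real q ^ i - 1)"
  have P0: "?P n \<noteq> 0" for n
  proof -
    have "real q ^ i \<noteq> 1" if "i \<in> {1..n}" for i
    proof -
      have "1 < real q ^ i" by (rule one_less_power) (use q that in auto)
      thus ?thesis by linarith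
    qed
    thus ?thesis by simp
  qed
  have qf: "q_factorial q n = ?P n / (real q - 1) ^ n" for n
    by (simp add: q_factorial_def q_number_def prod_dividef)
  \<comment> \<open>Taking \<open>q ^ i\<close> out of each factor of the number of independent lists leaves the quotient
    \<open>?P m / ?P (m - k)\<close>. The resulting power of \<open>q\<close> depends only on \<open>k\<close>, so it cancels between
    \<open>m = d\<close> and \<open>m = k\<close>.\<close>
  have step: "real (\<Prod>i<k. q ^ m - q ^ i) * ?P (m - k) = real q ^ (\<Sum>i<k. i) * ?P m" if "k \<le> m" for k m
    using that
  proof (induction k)
    case 0
    show ?case by simp
  next
    case (Suc k)
    have qm: "real (q ^ m - q ^ k) = real q ^ k * (real q ^ (m - k) - 1)"
    proof -
      have "q ^ k \<le> q ^ m" using Suc.prems q by (intro power_increasing) auto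
      thus ?thesis using Suc.prems by (simp add: of_nat_diff right_diff_distrib flip: power_add)
    qed
    have "m - k = Suc (m - Suc k)" using Suc.prems by simp
    hence P: "?P (m - k) = (real q ^ (m - k) - 1) * ?P (m - Suc k)"
      by (simp add: mult.commute)
    have "real (\<Prod>i<Suc k. q ^ m - q ^ i) * ?P (m - Suc k) =
       real q ^ k * (real (\<Prod>i<k. q ^ m - q ^ i) * ?P (m - k))"
      unfolding P by (simp add: qm)
    also have "\<dots> = real q ^ (\<Sum>i<Suc k. i) * ?P m"
      using Suc by (simp add: power_add mult_ac)
    finally show ?case .
  qed
  let ?N = "card (Gr k :: ('f ^ 'd) set set)"
  have "{y \<in> Gr k. y \<inter> {0} = {0}} = (Gr k :: ('f ^ 'd) set set)"
    using Gr_D(1) vec.subspace_0 by fastforce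
  hence "?N * (\<Prod>i<k. q ^ k - q ^ i) = (\<Prod>i<k. q ^ d - q ^ i)"
    using card_Gr_complementary[of "{0 :: 'f ^ 'd}" k, OF vec.subspace_single_0]
    by (simp add: q_def d_def)
  hence N: "real ?N * real (\<Prod>i<k. q ^ k - q ^ i) = real (\<Prod>i<k. q ^ d - q ^ i)"
    by (metis of_nat_mult)
  let ?Q = "real q ^ (\<Sum>i<k. i)"
  have "?Q * (real ?N * ?P k * ?P (d - k)) = real ?N * (?Q * ?P k) * ?P (d - k)"
    by (simp only: mult_ac)
  also have "?Q * ?P k = real (\<Prod>i<k. q ^ k - q ^ i)"
    using step[of k k] by simp
  also have "real ?N * \<dots> * ?P (d - k) = ?Q * ?P d"
    unfolding N by (rule step[OF kd])
  finally have "real ?N * ?P k * ?P (d - k) = ?P d"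
    using q by simp
  hence "real ?N = ?P d / (?P k * ?P (d - k))"
    using P0[of k] P0[of "d - k"] by (simp only: nonzero_eq_divide_eq mult.assoc mult_eq_0_iff simp_thms)
  also have "\<dots> = gaussian_binomial q d k"
  proof -
    have "(real q - 1) ^ d = (real q - 1) ^ k * (real q - 1) ^ (d - k)"
      using kd by (simp flip: power_add)
    thus ?thesis using q by (simp add: gaussian_binomial_def qf)
  qed
  finally show ?thesis by (simp add: q_def d_def)
qed

section \<open>The orbit of transverse pairs\<close>

definition coordinate_space :: "'d set \<Rightarrow> ('f::field ^ 'd) set" where
  "coordinate_space I = {z. \<forall>i. i \<notin> I \<longrightarrow> z $ i = 0}"

lemma coordinate_space_Gr: "coordinate_space I \<in> Gr (card I)"
  by (auto simp: Gr_def coordinate_space_def dim_substandard_cart intro!: vec.subspaceI)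

lemma dual_coordinate_space:
  "dual_space (coordinate_space I :: ('f::field ^ 'd) set) = coordinate_space (- I)"
proof (intro equalityI subsetI)
  fix z :: "'f ^ 'd" assume z: "z \<in> dual_space (coordinate_space I)"
  have "z $ i = 0" if "i \<in> I" for i
  proof -
    have "axis i 1 \<in> coordinate_space I" using that by (auto simp: coordinate_space_def axis_def)
    hence "dotp (axis i 1) z = 0" using z unfolding dual_space_def dotp_def by blast
    thus ?thesis by (simp add: dotp_axis_left)
  qed
  thus "z \<in> coordinate_space (- I)" by (simp add: coordinate_space_def)
next
  fix z :: "'f ^ 'd" assume "z \<in> coordinate_space (- I)"
  hence "v $ i * z $ i = 0" if "v \<in> coordinate_space I" for v i
    using that by (cases "i \<in> I") (auto simp: coordinate_space_def)
  hence "(\<Sum>i\<in>UNIV. v $ i * z $ i) = 0" if "v \<in> coordinate_space I" for v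
    using that by (intro sum.neutral) blast
  thus "z \<in> dual_space (coordinate_space I)" by (simp add: dual_space_def)
qed

lemma act_X_Int_dual_space_act_Y:
  assumes "invertible g" and "x \<inter> dual_space y = {0}"
  shows "act_X g x \<inter> dual_space (act_Y g y) = {0}"
proof -
  have "inj ((*v) g)"
    using matrix_inv_vector(2)[OF assms(1)] by (metis injI)
  hence "act_X g x \<inter> act_X g (dual_space y) = act_X g (x \<inter> dual_space y)"
    unfolding act_X_def by (simp add: image_Int)
  thus ?thesis by (simp add: dual_space_act_Y[OF assms(1)] assms(2) act_X_def)
qed

text \<open>
  Since \<open>x\<close> and \<open>dual_space y\<close> intersect trivially and have complementary dimensions, a frame of \<open>x\<close>
  indexed by \<open>I\<close> and one of \<open>dual_space y\<close> indexed by \<open>- I\<close> are together the columns of an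
  invertible \<open>g\<close>. It maps the coordinate space of \<open>I\<close> to \<open>x\<close> and that of \<open>- I\<close>, its dual, to
  \<open>dual_space y\<close>; biduality then gives the claim about \<open>y\<close>.
\<close>

lemma transverse_pair_standard_form:
  fixes x y :: "('f::field ^ 'd) set" and I :: "'d set"
  assumes x: "x \<in> Gr (card I)" and y: "y \<in> Gr (card I)" and xy: "x \<inter> dual_space y = {0}"
  shows "\<exists>g. invertible g \<and> act_X g (coordinate_space I) = x \<and> act_Y g (coordinate_space I) = y"
proof -
  obtain v where v: "frame I v x" using Gr_has_frame[OF x] by blast
  have "card (- I) = CARD('d) - card I" by (simp add: Compl_eq_Diff_UNIV card_Diff_subset)
  then obtain u where u: "frame (- I) u (dual_space y)"
    using Gr_has_frame[of "dual_space y" "- I"] dual_space_Gr[OF y] by auto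
  define g :: "'f ^ 'd ^ 'd" where "g = transpose (\<chi> i. if i \<in> I then v i else u i)"
  have g: "g *v z = (\<Sum>i\<in>I. z $ i *s v i) + (\<Sum>i\<in>- I. z $ i *s u i)" for z
  proof -
    have "column i g = (if i \<in> I then v i else u i)" for i
      by (simp add: g_def column_def transpose_def vec_eq_iff)
    hence "g *v z = (\<Sum>i\<in>UNIV. z $ i *s (if i \<in> I then v i else u i))"
      unfolding matrix_mult_sum by simp
    also have "\<dots> = (\<Sum>i\<in>I \<union> - I. z $ i *s (if i \<in> I then v i else u i))" by simp
    also have "\<dots> = (\<Sum>i\<in>I. z $ i *s v i) + (\<Sum>i\<in>- I. z $ i *s u i)"
      by (subst sum.union_disjoint) auto
    finally show ?thesis .
  qed
  have "z = 0" if "g *v z = 0" for z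
  proof -
    define a where "a = (\<Sum>i\<in>I. z $ i *s v i)"
    define b where "b = (\<Sum>i\<in>- I. z $ i *s u i)"
    have ab: "a = - b" using that unfolding g a_def[symmetric] b_def[symmetric]
      by (simp add: eq_neg_iff_add_eq_0)
    have "a \<in> x" using v by (auto simp: frame_def a_def)
    moreover have "b \<in> dual_space y" using u by (auto simp: frame_def b_def)
    hence "a \<in> dual_space y" unfolding ab by (rule vec.subspace_neg[OF subspace_dual_space])
    ultimately have "a = 0" using xy by blast
    hence "b = 0" using ab by simp
    have "\<forall>i\<in>I. z $ i = 0" using v \<open>a = 0\<close> unfolding a_def frame_def by blast
    moreover have "\<forall>i\<in>- I. z $ i = 0" using u \<open>b = 0\<close> unfolding b_def frame_def by blast
    ultimately show "z = 0" by (auto simp: vec_eq_iff)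
  qed
  hence inv: "invertible g"
    unfolding invertible_left_inverse matrix_left_invertible_ker by blast
  have gE: "act_X g (coordinate_space I) = x"
  proof (intro equalityI subsetI)
    fix w assume "w \<in> act_X g (coordinate_space I)"
    then obtain z where "w = g *v z" "z \<in> coordinate_space I" by (auto simp: act_X_def)
    hence "w = (\<Sum>i\<in>I. z $ i *s v i)" by (simp add: g coordinate_space_def)
    thus "w \<in> x" using v by (auto simp: frame_def)
  next
    fix w assume "w \<in> x"
    then obtain a where a: "w = (\<Sum>i\<in>I. a i *s v i)" using v by (auto simp: frame_def)
    define z where "z = (\<chi> i. if i \<in> I then a i else 0)"
    have "w = g *v z" by (simp add: g a z_def)
    moreover have "z \<in> coordinate_space I" by (simp add: z_def coordinate_space_def)
    ultimately show "w \<in> act_X g (coordinate_space I)" by (simp add: act_X_def)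
  qed
  have gE': "act_X g (coordinate_space (- I)) = dual_space y"
  proof (intro equalityI subsetI)
    fix w assume "w \<in> act_X g (coordinate_space (- I))"
    then obtain z where "w = g *v z" "z \<in> coordinate_space (- I)" by (auto simp: act_X_def)
    hence "w = (\<Sum>i\<in>- I. z $ i *s u i)" by (simp add: g coordinate_space_def)
    thus "w \<in> dual_space y" using u by (auto simp: frame_def)
  next
    fix w assume "w \<in> dual_space y"
    then obtain a where a: "w = (\<Sum>i\<in>- I. a i *s u i)" using u by (auto simp: frame_def)
    define z where "z = (\<chi> i. if i \<in> I then 0 else a i)"
    have "w = g *v z" by (simp add: g a z_def)
    moreover have "z \<in> coordinate_space (- I)" by (simp add: z_def coordinate_space_def)
    ultimately show "w \<in> act_X g (coordinate_space (- I))" by (simp add: act_X_def)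
  qed
  have "dual_space (act_Y g (coordinate_space I)) = dual_space y"
    by (simp add: dual_space_act_Y[OF inv] dual_coordinate_space gE')
  moreover have "act_Y g (coordinate_space I) \<in> Gr (card I)"
    unfolding act_Y_eq_act_X
    by (rule act_X_Gr[OF invertible_transpose_inv[OF inv] coordinate_space_Gr])
  ultimately have "act_Y g (coordinate_space I) = y"
    using dual_space_dual_space y by metis
  with inv gE show ?thesis by blast
qed

lemma GL_orbit_coordinate_space:
  fixes I :: "'d::finite set"
  shows "GL_orbit (coordinate_space I, coordinate_space I) =
    {(x :: ('f::field ^ 'd) set, y). x \<in> Gr (card I) \<and> y \<in> Gr (card I) \<and> x \<inter> dual_space y = {0}}"
proof -
  let ?E = "coordinate_space I :: ('f ^ 'd) set"
  have E: "?E \<inter> dual_space ?E = {0}"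
    unfolding dual_coordinate_space by (auto simp: coordinate_space_def vec_eq_iff, metis)
  have "act_X g ?E \<in> Gr (card I) \<and> act_Y g ?E \<in> Gr (card I) \<and>
      act_X g ?E \<inter> dual_space (act_Y g ?E) = {0}" if "invertible g" for g
    using that act_X_Int_dual_space_act_Y[OF that E] invertible_transpose_inv[OF that]
    by (simp add: act_Y_eq_act_X act_X_Gr coordinate_space_Gr)
  hence "GL_orbit (?E, ?E) \<subseteq>
      {(x, y). x \<in> Gr (card I) \<and> y \<in> Gr (card I) \<and> x \<inter> dual_space y = {0}}"
    by (auto simp: GL_orbit_def GL_def)
  moreover have "(x, y) \<in> GL_orbit (?E, ?E)"
    if xy: "x \<in> Gr (card I)" "y \<in> Gr (card I)" "x \<inter> dual_space y = {0}" for x y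
  proof -
    obtain g where "invertible g" "act_X g ?E = x" "act_Y g ?E = y"
      using transverse_pair_standard_form[OF xy] by blast
    thus ?thesis by (auto simp: GL_orbit_def GL_def)
  qed
  ultimately show ?thesis by blast
qed

section \<open>Separating two rows by a dilation\<close>

text \<open>
  Biduality provides a linear form \<open>f\<close> that vanishes on \<open>x\<close> but not at some \<open>u\<close> in \<open>x'\<close>; normalise it
  to \<open>f u = 1\<close>. The map \<open>z \<mapsto> z + (c - 1) f(z) u\<close> fixes the kernel of \<open>f\<close> and multiplies \<open>u\<close> by \<open>c\<close>.
  The frame of \<open>x'\<close> consists of \<open>u\<close> and a basis of the part of \<open>x'\<close> in the kernel, so that the effect
  on Gram determinants can be read off from a single row.
\<close>

lemma exists_separating_dilation:
  fixes x x' :: "('f::field ^ 'd) set" and I :: "'d set"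
  assumes x: "x \<in> Gr (card I)" and x': "x' \<in> Gr (card I)" and ne: "x \<noteq> x'" and c: "c \<noteq> 0"
  shows "\<exists>g v i. invertible g \<and> (\<forall>z\<in>x. g *v z = z) \<and> frame I v x' \<and> i \<in> I \<and>
    (\<forall>j\<in>I. g *v v j = (if j = i then c *s v j else v j))"
proof -
  obtain u where u: "u \<in> x'" "u \<notin> x"
    using vec.subspace_dim_equal[of x' x] Gr_D[OF x] Gr_D[OF x'] ne by auto
  have "u \<notin> dual_space (dual_space x)" using u(2) dual_space_dual_space[OF x] by simp
  then obtain f' where f': "f' \<in> dual_space x" "dotp f' u \<noteq> 0"
    by (auto simp: dual_space_def dotp_def)
  define f where "f = inverse (dotp f' u) *s f'"
  have fu: "dotp f u = 1" using f'(2) by (simp add: f_def dotp_scale_left)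
  have fx: "dotp f z = 0" if "z \<in> x" for z
  proof -
    have "dotp z f' = 0" using f'(1) that by (simp add: dual_space_def dotp_def)
    thus ?thesis by (simp add: f_def dotp_scale_left dotp_commute[of f'])
  qed
  define T :: "'f \<Rightarrow> 'f ^ 'd ^ 'd" where "T b = mat 1 + (\<chi> i j. (b - 1) * u $ i * f $ j)" for b
  have T: "T b *v z = z + ((b - 1) * dotp f z) *s u" for b z
  proof -
    have "(\<chi> i j. (b - 1) * u $ i * f $ j) *v z = ((b - 1) * dotp f z) *s u"
      by (simp add: vec_eq_iff matrix_vector_mult_def dotp_def sum_distrib_left sum_distrib_right mult_ac)
    thus ?thesis by (simp add: T_def matrix_vector_mult_add_rdistrib)
  qed
  have "T (inverse c) *v (T c *v z) = z" for z
    unfolding T dotp_add_right dotp_scale_right fu using c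
    by (simp add: vec_eq_iff field_simps)
  hence "T c *v z = 0 \<Longrightarrow> z = 0" for z by (metis matrix_vector_mult_0_right)
  hence inv: "invertible (T c)"
    unfolding invertible_left_inverse matrix_left_invertible_ker by blast
  define K where "K = {z \<in> x'. dotp f z = 0}"
  have K: "vec.subspace K"
    using Gr_D(1)[OF x'] unfolding K_def
    by (auto intro!: vec.subspaceI simp: vec.subspace_0 vec.subspace_add vec.subspace_scale
        dotp_add_right dotp_scale_right)
  obtain B where B: "B \<subseteq> K" "vec.independent B" "K \<subseteq> vec.span B" "card B = vec.dim K"
    by (rule vec.basis_exists)
  have spanB: "vec.span B = K" using B K by (metis vec.span_subspace)
  have uK: "u \<notin> K" using fu by (simp add: K_def)
  have indep: "vec.independent (insert u B)"
    using B(2) uK spanB by (simp add: vec.independent_insert)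
  have span: "vec.span (insert u B) = x'"
  proof (rule vec.span_subspace)
    show "insert u B \<subseteq> x'" using B(1) u(1) by (auto simp: K_def)
    show "x' \<subseteq> vec.span (insert u B)"
    proof
      fix z assume "z \<in> x'"
      hence "z - dotp f z *s u \<in> K"
        using Gr_D(1)[OF x'] u(1) fu
        by (simp add: K_def vec.subspace_diff vec.subspace_scale dotp_diff_right dotp_scale_right)
      thus "z \<in> vec.span (insert u B)" unfolding vec.span_breakdown_eq spanB by blast
    qed
  qed (rule Gr_D(1)[OF x'])
  have "card (insert u B) = card I"
    using vec.dim_span_eq_card_independent[OF indep] span Gr_D(2)[OF x'] by simp
  moreover have "finite (insert u B)" using indep by (rule vec.finiteI_independent)
  ultimately obtain v where v: "bij_betw v I (insert u B)"
    by (metis finite finite_same_card_bij)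
  hence frame: "frame I v x'"
    using frame_of_basis[of v I] indep span by (simp add: bij_betw_def)
  have "u \<in> v ` I" using v by (simp add: bij_betw_def)
  then obtain i where i: "i \<in> I" "v i = u" by blast
  have "T c *v v j = (if j = i then c *s v j else v j)" if "j \<in> I" for j
  proof (cases "j = i")
    case True
    thus ?thesis by (simp add: T i(2) fu vec_eq_iff algebra_simps)
  next
    case False
    have "v j \<in> insert u B" "v j \<noteq> u"
      using v that i False by (auto simp: bij_betw_def inj_on_def)
    hence "dotp f (v j) = 0" using B(1) by (auto simp: K_def)
    thus ?thesis using False by (simp add: T)
  qed
  moreover have "T c *v z = z" if "z \<in> x" for z using fx[OF that] by (simp add: T)
  ultimately show ?thesis using inv frame i(1) by blast
qed

lemma gram_det_transpose:
  "gram_det I (\<lambda>i. g *v v i) w = gram_det I v (\<lambda>i. transpose g *v w i)"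
  unfolding gram_det_def gram_def dotp_matrix[of g] ..

lemma gram_det_cong:
  assumes "\<And>i. i \<in> I \<Longrightarrow> v i = v' i" and "\<And>i. i \<in> I \<Longrightarrow> w i = w' i"
  shows "gram_det I v w = gram_det I v' w'"
proof -
  have "gram I v w = gram I v' w'" by (simp add: gram_def vec_eq_iff assms)
  thus ?thesis by (simp add: gram_det_def)
qed

lemma gram_det_scale_row:
  fixes I :: "'d::finite set" and v v' :: "'d \<Rightarrow> 'f::field ^ 'd"
  assumes "i \<in> I" and "\<And>j. j \<in> I \<Longrightarrow> v' j = (if j = i then c *s v j else v j)"
  shows "gram_det I v' w = c * gram_det I v w"
proof -
  have row: "gram I v' w = (\<chi> j. if j = i then c *s (gram I v w $ j) else gram I v w $ j)"
  proof -
    have "dotp (v' j) z = (if j = i then c * dotp (v j) z else dotp (v j) z)" if "j \<in> I" for j z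
      by (simp add: assms(2)[OF that] dotp_scale_left)
    thus ?thesis using assms(1) by (auto simp: vec_eq_iff gram_def)
  qed
  have "gram_det I v' w = c * det (\<chi> j. if j = i then gram I v w $ j else gram I v w $ j)"
    unfolding gram_det_def row by (rule det_row_mul)
  thus ?thesis by (simp add: gram_det_def vec_lambda_eta)
qed

text \<open>
  The factor \<open>c\<close> does not depend on the frame: two frames of \<open>x'\<close> have proportional Gram
  determinants, so the special frame of the dilation may be replaced by the given one.
\<close>

lemma gram_det_separation:
  fixes I :: "'d::finite set" and b b' :: "'d \<Rightarrow> 'f::field ^ 'd"
  assumes "x \<in> Gr (card I)" and "x' \<in> Gr (card I)" and "x \<noteq> x'" and "c \<noteq> 0"
    and b: "frame I b x" and b': "frame I b' x'"
  shows "\<exists>g. invertible g \<and>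
    (\<forall>w. gram_det I b (\<lambda>i. g *v w i) = gram_det I b w) \<and>
    (\<forall>w. gram_det I b' (\<lambda>i. g *v w i) = c * gram_det I b' w)"
proof -
  obtain g v i where g: "invertible g" "\<forall>z\<in>x. g *v z = z" and v: "frame I v x'"
    and i: "i \<in> I" "\<forall>j\<in>I. g *v v j = (if j = i then c *s v j else v j)"
    using exists_separating_dilation[OF assms(1-4)] by metis
  obtain a where a: "\<And>w. gram_det I b' w = a * gram_det I v w"
    using gram_det_frame_change[OF v b'] by blast
  have "gram_det I b (\<lambda>i. transpose g *v w i) = gram_det I b w" for w
    unfolding gram_det_transpose[symmetric]
    by (rule gram_det_cong) (use g(2) frame_mem[OF b] in auto)
  moreover have "gram_det I b' (\<lambda>i. transpose g *v w i) = c * gram_det I b' w" for w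
  proof -
    have "gram_det I v (\<lambda>i. transpose g *v w i) = c * gram_det I v w"
      unfolding gram_det_transpose[symmetric]
      by (rule gram_det_scale_row[OF i(1)]) (use i(2) in blast)
    thus ?thesis by (simp only: a mult.left_commute)
  qed
  moreover have "invertible (transpose g)" using g(1) by (simp add: invertible_det_nz)
  ultimately show ?thesis by blast
qed

section \<open>Monomial matrices\<close>

text \<open>
  A permutation matrix with the entry in column \<open>j\<close> replaced by \<open>a j\<close>: the general form of a
  monomial matrix, by which permutations are lifted.
\<close>

definition twisted_perm_mat :: "'i set \<Rightarrow> ('i \<Rightarrow> 'i) \<Rightarrow> ('i \<Rightarrow> complex) \<Rightarrow> 'i \<Rightarrow> 'i \<Rightarrow> complex" where
  "twisted_perm_mat I \<sigma> a = (\<lambda>i j. if j \<in> I \<and> i = \<sigma> j then a j else 0)"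

lemma perm_mat_eq_twisted: "perm_mat I \<sigma> = twisted_perm_mat I \<sigma> (\<lambda>_. 1)"
  by (simp add: perm_mat_def twisted_perm_mat_def)

lemma twisted_perm_mat_fixes:
  assumes fin: "finite I" "finite J" and \<sigma>: "bij_betw \<sigma> I I" and \<tau>: "bij_betw \<tau> J J"
    and M: "M \<in> matrices I J"
    and eq: "\<And>i j. i \<in> I \<Longrightarrow> j \<in> J \<Longrightarrow> M (\<sigma> i) (\<tau> j) = a i * M i j * cnj (b j)"
  shows "fixes_mat I J M (twisted_perm_mat I \<sigma> a, twisted_perm_mat J \<tau> b)"
proof -
  let ?P = "twisted_perm_mat I \<sigma> a" and ?Q = "twisted_perm_mat J \<tau> b"
  have "(\<Sum>l\<in>J. (\<Sum>m\<in>I. ?P i m * M m l) * cnj (?Q j l)) = M i j" for i j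
  proof (cases "i \<in> I \<and> j \<in> J")
    case True
    hence "i \<in> \<sigma> ` I" "j \<in> \<tau> ` J"
      using bij_betw_imp_surj_on[OF \<sigma>] bij_betw_imp_surj_on[OF \<tau>] by simp_all
    then obtain i' j' where ij: "i' \<in> I" "i = \<sigma> i'" "j' \<in> J" "j = \<tau> j'"
      by blast
    have P: "?P i m = (if m = i' then a i' else 0)" if "m \<in> I" for m
      using that ij \<sigma> by (auto simp: twisted_perm_mat_def bij_betw_def inj_on_def)
    have Q: "?Q j l = (if l = j' then b j' else 0)" if "l \<in> J" for l
      using that ij \<tau> by (auto simp: twisted_perm_mat_def bij_betw_def inj_on_def)
    have "(\<Sum>l\<in>J. (\<Sum>m\<in>I. ?P i m * M m l) * cnj (?Q j l)) =
        (\<Sum>l\<in>J. (\<Sum>m\<in>I. if m = i' then a i' * M m l else 0) * (if l = j' then cnj (b j') else 0))"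
      by (intro sum.cong arg_cong2[where f = times]) (auto simp: P Q)
    also have "\<dots> = (\<Sum>l\<in>J. if l = j' then a i' * M i' l * cnj (b j') else 0)"
      using fin ij by (intro sum.cong) auto
    also have "\<dots> = M i j" using fin ij by (simp add: eq)
    finally show ?thesis .
  next
    case False
    have "?P i m = 0" if "i \<notin> I" "m \<in> I" for m
      using that \<sigma> by (auto simp: twisted_perm_mat_def bij_betw_def)
    moreover have "?Q j l = 0" if "j \<notin> J" "l \<in> J" for l
      using that \<tau> by (auto simp: twisted_perm_mat_def bij_betw_def)
    moreover have "M i j = 0" using M False by (auto simp: matrices_def)
    ultimately show ?thesis using False by (cases "i \<in> I") auto
  qed
  thus ?thesis by (simp add: fixes_mat_def mat_prod_def conj_transpose_def)
qed

lemma twisted_perm_mat_monomial: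
  assumes \<sigma>: "bij_betw \<sigma> I I" and a: "\<And>i. i \<in> I \<Longrightarrow> a i \<in> roots_of_unity n"
  shows "twisted_perm_mat I \<sigma> a \<in> monomial_matrices n I"
proof -
  have nz: "twisted_perm_mat I \<sigma> a i j \<noteq> 0 \<longleftrightarrow> j \<in> I \<and> i = \<sigma> j" for i j
    using a by (auto simp: twisted_perm_mat_def roots_of_unity_def)
  have \<sigma>I: "\<sigma> j \<in> I" if "j \<in> I" for j using \<sigma> that by (auto simp: bij_betw_def)
  have "\<exists>!j. j \<in> I \<and> twisted_perm_mat I \<sigma> a i j \<noteq> 0" if "i \<in> I" for i
    unfolding nz using bij_betw_imp_surj_on[OF \<sigma>] bij_betw_imp_inj_on[OF \<sigma>] that
    by (auto simp: inj_on_def image_iff)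
  moreover have "\<exists>!i. i \<in> I \<and> twisted_perm_mat I \<sigma> a i j \<noteq> 0" if "j \<in> I" for j
    unfolding nz using \<sigma>I[OF that] that by blast
  moreover have "twisted_perm_mat I \<sigma> a \<in> matrices I I"
    using \<sigma>I by (auto simp: matrices_def twisted_perm_mat_def)
  moreover have "twisted_perm_mat I \<sigma> a i j \<in> roots_of_unity n"
    if "twisted_perm_mat I \<sigma> a i j \<noteq> 0" for i j
    using that a unfolding nz by (simp add: twisted_perm_mat_def)
  ultimately show ?thesis by (simp add: monomial_matrices_def)
qed

lemma cmod_root_of_unity:
  assumes "z \<in> roots_of_unity n" and "0 < n"
  shows "cmod z = 1"
proof -
  have "cmod z ^ n = 1" using assms(1) by (simp add: roots_of_unity_def flip: norm_power)
  thus ?thesis using power_eq_imp_eq_base[of "cmod z" n 1] assms(2) by simp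
qed

lemma cnj_root_of_unity: "z \<in> roots_of_unity n \<Longrightarrow> cnj z \<in> roots_of_unity n"
  by (simp add: roots_of_unity_def flip: complex_cnj_power)

lemma abs_twisted_perm_mat:
  assumes "\<And>i. i \<in> I \<Longrightarrow> cmod (a i) = 1"
  shows "abs_mat (twisted_perm_mat I \<sigma> a) = perm_mat I \<sigma>"
  using assms by (auto simp: abs_mat_def twisted_perm_mat_def perm_mat_def fun_eq_iff)

section \<open>The generalized weighing matrix\<close>

locale root_of_unity_character =
  fixes \<psi> :: "'f::{field,finite} \<Rightarrow> complex" and n :: nat
  assumes n_pos: "0 < n"
    and mult: "\<psi> (x * y) = \<psi> x * \<psi> y"
    and zero: "\<psi> 0 = 0"
    and root: "x \<noteq> 0 \<Longrightarrow> \<psi> x \<in> roots_of_unity n"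
    and nontrivial: "\<exists>c. c \<noteq> 0 \<and> \<psi> c \<noteq> 1"
begin

lemma cmod_character: "cmod (\<psi> x) = (if x = 0 then 0 else 1)"
  using zero cmod_root_of_unity[OF root n_pos] by auto

lemma character_mult_cnj: "\<psi> x * cnj (\<psi> x) = (if x = 0 then 0 else 1)"
  using complex_norm_square[of "\<psi> x"] by (cases "x = 0") (simp_all add: cmod_character zero)

definition basis_of :: "'d::finite set \<Rightarrow> ('f ^ 'd) set \<Rightarrow> 'd \<Rightarrow> 'f ^ 'd" where
  "basis_of I x = (SOME v. frame I v x)"

definition pairing_det :: "'d::finite set \<Rightarrow> ('f ^ 'd) set \<Rightarrow> ('f ^ 'd) set \<Rightarrow> 'f" where
  "pairing_det I x y = gram_det I (basis_of I x) (basis_of I y)"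

definition weighing_matrix :: "'d::finite set \<Rightarrow> ('f ^ 'd) set \<Rightarrow> ('f ^ 'd) set \<Rightarrow> complex" where
  "weighing_matrix I = (\<lambda>x y. if x \<in> Gr (card I) \<and> y \<in> Gr (card I) then \<psi> (pairing_det I x y) else 0)"

lemma frame_basis_of:
  assumes "x \<in> Gr (card I)"
  shows "frame I (basis_of I x) x"
  unfolding basis_of_def using Gr_has_frame[OF assms] by (rule someI_ex)

lemma pairing_det_nonzero_iff:
  assumes "x \<in> Gr (card I)" and "y \<in> Gr (card I)"
  shows "pairing_det I x y \<noteq> 0 \<longleftrightarrow> x \<inter> dual_space y = {0}"
  unfolding pairing_det_def by (rule gram_det_nonzero_iff[OF frame_basis_of[OF assms(1)] frame_basis_of[OF assms(2)]])

lemma pairing_det_commute: "pairing_det I x y = pairing_det I y x"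
  unfolding pairing_det_def by (rule gram_det_commute)

lemma basis_of_act_X:
  fixes I :: "'d::finite set" and g :: "'f ^ 'd ^ 'd"
  assumes g: "invertible g"
  shows "\<exists>e. \<forall>x\<in>Gr (card I). e x \<noteq> 0 \<and>
    (\<forall>w. gram_det I (basis_of I (act_X g x)) w = e x * gram_det I (\<lambda>i. g *v basis_of I x i) w)"
proof -
  have "\<forall>x\<in>Gr (card I). \<exists>c. c \<noteq> 0 \<and>
      (\<forall>w. gram_det I (basis_of I (act_X g x)) w = c * gram_det I (\<lambda>i. g *v basis_of I x i) w)"
    using gram_det_frame_change[OF frame_image[OF g frame_basis_of] frame_basis_of[OF act_X_Gr[OF g]]]
    by blast
  thus ?thesis by metis
qed

text \<open>
  The image under \<open>g\<close> of the chosen frame of \<open>x\<close> is a frame of the image of \<open>x\<close>, but in general not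
  the chosen one; \<open>e\<close> and \<open>e'\<close> account for the change of frames.
\<close>

lemma pairing_det_GL_action:
  fixes I :: "'d::finite set" and g :: "'f ^ 'd ^ 'd"
  assumes g: "invertible g"
  shows "\<exists>e e'. (\<forall>x\<in>Gr (card I). e x \<noteq> 0 \<and> e' x \<noteq> 0) \<and>
    (\<forall>x\<in>Gr (card I). \<forall>y\<in>Gr (card I).
       pairing_det I (act_X g x) (act_Y g y) = e x * pairing_det I x y * e' y)"
proof -
  let ?h = "transpose (matrix_inv g)"
  obtain e where e: "\<forall>x\<in>Gr (card I). e x \<noteq> 0 \<and>
      (\<forall>w. gram_det I (basis_of I (act_X g x)) w = e x * gram_det I (\<lambda>i. g *v basis_of I x i) w)"
    using basis_of_act_X[OF g] by blast
  obtain e' where e': "\<forall>y\<in>Gr (card I). e' y \<noteq> 0 \<and>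
      (\<forall>w. gram_det I (basis_of I (act_X ?h y)) w = e' y * gram_det I (\<lambda>i. ?h *v basis_of I y i) w)"
    using basis_of_act_X[OF invertible_transpose_inv[OF g]] by blast
  have "pairing_det I (act_X g x) (act_Y g y) = e x * pairing_det I x y * e' y"
    if x: "x \<in> Gr (card I)" and y: "y \<in> Gr (card I)" for x y
  proof -
    have "pairing_det I (act_X g x) (act_Y g y) =
        e x * gram_det I (\<lambda>i. g *v basis_of I x i) (basis_of I (act_X ?h y))"
      using e x by (simp only: pairing_det_def act_Y_eq_act_X)
    also have "\<dots> = e x * (e' y * gram_det I (\<lambda>i. ?h *v basis_of I y i) (\<lambda>i. g *v basis_of I x i))"
      using e' y by (simp only: gram_det_commute[of I "\<lambda>i. g *v basis_of I x i"])
    also have "gram_det I (\<lambda>i. ?h *v basis_of I y i) (\<lambda>i. g *v basis_of I x i) = pairing_det I x y"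
      using gram_det_commute gram_det_contragredient[OF g] unfolding pairing_det_def by metis
    finally show ?thesis by (simp only: mult_ac)
  qed
  with e e' show ?thesis by blast
qed

lemma abs_weighing_matrix:
  "abs_mat (weighing_matrix I) =
    char_mat {(x, y). x \<in> Gr (card I) \<and> y \<in> Gr (card I) \<and> x \<inter> dual_space y = {0}}"
proof -
  have "cmod (weighing_matrix I x y) =
      (if x \<in> Gr (card I) \<and> y \<in> Gr (card I) \<and> x \<inter> dual_space y = {0} then 1 else 0)" for x y
    using pairing_det_nonzero_iff[of x I y]
    by (cases "x \<in> Gr (card I) \<and> y \<in> Gr (card I)") (auto simp: weighing_matrix_def cmod_character simp del: Int_iff)
  thus ?thesis by (simp add: abs_mat_def char_mat_def fun_eq_iff)
qed

text \<open>
  A substitution \<open>y \<mapsto> g y\<close> of the columns that multiplies the row of \<open>x'\<close>, but not that of \<open>x\<close>, by a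
  factor \<open>c\<close> with \<open>\<psi> c \<noteq> 1\<close> shows that the sum equals a multiple of itself by a number other than
  \<open>1\<close>. The factors \<open>e y\<close> from the choice of frames occur in both rows and cancel, because their
  characters have absolute value \<open>1\<close>.
\<close>

lemma weighing_matrix_rows_orthogonal:
  fixes I :: "'d::finite set" and x x' :: "('f ^ 'd) set"
  assumes x: "x \<in> Gr (card I)" and x': "x' \<in> Gr (card I)" and ne: "x \<noteq> x'"
  shows "(\<Sum>y\<in>Gr (card I). \<psi> (pairing_det I x y) * cnj (\<psi> (pairing_det I x' y))) = 0"
proof -
  obtain c where c: "c \<noteq> 0" "\<psi> c \<noteq> 1" using nontrivial by blast
  obtain g where g: "invertible g"
    and gx: "\<And>w. gram_det I (basis_of I x) (\<lambda>i. g *v w i) = gram_det I (basis_of I x) w"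
    and gx': "\<And>w. gram_det I (basis_of I x') (\<lambda>i. g *v w i) = c * gram_det I (basis_of I x') w"
    using gram_det_separation[OF x x' ne c(1) frame_basis_of[OF x] frame_basis_of[OF x']] by blast
  obtain e where e: "\<forall>y\<in>Gr (card I). e y \<noteq> 0 \<and>
      (\<forall>w. gram_det I (basis_of I (act_X g y)) w = e y * gram_det I (\<lambda>i. g *v basis_of I y i) w)"
    using basis_of_act_X[OF g] by blast
  have mx: "pairing_det I x (act_X g y) = e y * pairing_det I x y" if "y \<in> Gr (card I)" for y
    using e that gx unfolding pairing_det_def by (metis gram_det_commute)
  have mx': "pairing_det I x' (act_X g y) = e y * (c * pairing_det I x' y)" if "y \<in> Gr (card I)" for y
    using e that gx' unfolding pairing_det_def by (metis gram_det_commute)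
  let ?S = "\<Sum>y\<in>Gr (card I). \<psi> (pairing_det I x y) * cnj (\<psi> (pairing_det I x' y))"
  have "?S = (\<Sum>y\<in>Gr (card I). \<psi> (pairing_det I x (act_X g y)) * cnj (\<psi> (pairing_det I x' (act_X g y))))"
    by (rule sum.reindex_bij_betw[OF bij_betw_act_X[OF g], symmetric])
  also have "\<dots> = (\<Sum>y\<in>Gr (card I). cnj (\<psi> c) * (\<psi> (pairing_det I x y) * cnj (\<psi> (pairing_det I x' y))))"
  proof (rule sum.cong[OF refl])
    fix y :: "('f ^ 'd) set" assume y: "y \<in> Gr (card I)"
    have "\<psi> (e y) * cnj (\<psi> (e y)) = 1"
      using e y by (simp add: character_mult_cnj)
    moreover have "\<psi> (pairing_det I x (act_X g y)) * cnj (\<psi> (pairing_det I x' (act_X g y))) =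
        (\<psi> (e y) * cnj (\<psi> (e y))) * (cnj (\<psi> c) * (\<psi> (pairing_det I x y) * cnj (\<psi> (pairing_det I x' y))))"
      by (simp add: mx[OF y] mx'[OF y] mult)
    ultimately show "\<psi> (pairing_det I x (act_X g y)) * cnj (\<psi> (pairing_det I x' (act_X g y))) =
        cnj (\<psi> c) * (\<psi> (pairing_det I x y) * cnj (\<psi> (pairing_det I x' y)))" by simp
  qed
  also have "\<dots> = cnj (\<psi> c) * ?S" by (simp add: sum_distrib_left)
  finally have "(1 - cnj (\<psi> c)) * ?S = 0" by (simp add: algebra_simps)
  moreover have "cnj (\<psi> c) \<noteq> 1" using c(2) by (metis complex_cnj_cnj complex_cnj_one)
  ultimately show ?thesis by simp
qed

lemma weighing_matrix_row_norm:
  fixes I :: "'d::finite set" and x :: "('f ^ 'd) set"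
  assumes x: "x \<in> Gr (card I)"
  shows "(\<Sum>y\<in>Gr (card I). \<psi> (pairing_det I x y) * cnj (\<psi> (pairing_det I x y))) =
    of_nat (CARD('f) ^ (card I * (CARD('d) - card I)))"
proof -
  have "(\<Sum>y\<in>Gr (card I). \<psi> (pairing_det I x y) * cnj (\<psi> (pairing_det I x y))) =
      (\<Sum>y\<in>Gr (card I). if y \<inter> dual_space x = {0} then 1 else 0)"
  proof (rule sum.cong[OF refl])
    fix y :: "('f ^ 'd) set" assume y: "y \<in> Gr (card I)"
    show "\<psi> (pairing_det I x y) * cnj (\<psi> (pairing_det I x y)) = (if y \<inter> dual_space x = {0} then 1 else 0)"
      unfolding character_mult_cnj pairing_det_commute[of I x] pairing_det_nonzero_iff[OF y x, symmetric]
      by simp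
  qed
  also have "\<dots> = of_nat (card {y \<in> Gr (card I). y \<inter> dual_space x = {0}})"
    by (simp add: sum.If_cases Int_def)
  also have "card {y \<in> Gr (card I). y \<inter> dual_space x = {0}} = CARD('f) ^ (card I * (CARD('d) - card I))"
    by (rule card_Gr_transverse[OF x]) (simp add: card_mono)
  finally show ?thesis .
qed

lemma weighing_matrix_GW:
  fixes I :: "'d::finite set"
  shows "weighing_matrix I \<in> GW (Gr (card I)) (Gr (card I)) (card (Gr (card I) :: ('f ^ 'd) set set))
    (CARD('f) ^ (card I * (CARD('d) - card I))) n"
proof -
  let ?A = "weighing_matrix I"
  have "mat_prod (Gr (card I)) ?A (conj_transpose ?A) x x' =
      scalar_mat (Gr (card I)) (of_nat (CARD('f) ^ (card I * (CARD('d) - card I)))) x x'" for x x'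
  proof (cases "x \<in> Gr (card I) \<and> x' \<in> Gr (card I)")
    case True
    hence "mat_prod (Gr (card I)) ?A (conj_transpose ?A) x x' =
        (\<Sum>y\<in>Gr (card I). \<psi> (pairing_det I x y) * cnj (\<psi> (pairing_det I x' y)))"
      by (simp add: mat_prod_def conj_transpose_def weighing_matrix_def)
    thus ?thesis
      using True weighing_matrix_rows_orthogonal weighing_matrix_row_norm
      by (cases "x = x'") (auto simp: scalar_mat_def)
  next
    case False
    hence "mat_prod (Gr (card I)) ?A (conj_transpose ?A) x x' = 0"
      unfolding mat_prod_def conj_transpose_def weighing_matrix_def by (intro sum.neutral) auto
    thus ?thesis using False by (auto simp: scalar_mat_def)
  qed
  moreover have "\<psi> t \<in> insert 0 (roots_of_unity n)" for t
    using zero root by (cases "t = 0") auto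
  ultimately show ?thesis
    by (auto simp: GW_def matrices_def weighing_matrix_def fun_eq_iff)
qed

lemma GL_lifts:
  fixes I :: "'d::finite set" and g :: "'f ^ 'd ^ 'd"
  assumes g: "invertible g"
  shows "GL_perm (card I) g \<in> PermAut (Gr (card I)) (Gr (card I)) (abs_mat (weighing_matrix I))" (is ?perm)
    and "\<exists>(P, Q) \<in> Automorphisms n (Gr (card I)) (Gr (card I)) (weighing_matrix I).
      (abs_mat P, abs_mat Q) = GL_perm (card I) g" (is ?lift)
proof -
  let ?G = "Gr (card I) :: ('f ^ 'd) set set" and ?A = "weighing_matrix I"
  have bij: "bij_betw (act_X g) ?G ?G" "bij_betw (act_Y g) ?G ?G"
    unfolding act_Y_eq_act_X using g invertible_transpose_inv[OF g] by (simp_all add: bij_betw_act_X)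
  obtain e e' where e: "\<forall>x\<in>?G. e x \<noteq> 0 \<and> e' x \<noteq> 0"
    and ee: "\<forall>x\<in>?G. \<forall>y\<in>?G. pairing_det I (act_X g x) (act_Y g y) = e x * pairing_det I x y * e' y"
    using pairing_det_GL_action[OF g] by metis
  have A: "?A (act_X g x) (act_Y g y) = \<psi> (e x) * ?A x y * cnj (cnj (\<psi> (e' y)))"
    if "x \<in> ?G" "y \<in> ?G" for x y
    using that ee bij_betwE[OF bij(1)] bij_betwE[OF bij(2)] by (simp add: weighing_matrix_def mult)
  have Amat: "?A \<in> matrices ?G ?G" by (auto simp: matrices_def weighing_matrix_def)
  have e1: "\<psi> (e x) \<in> roots_of_unity n" "cnj (\<psi> (e' x)) \<in> roots_of_unity n" if "x \<in> ?G" for x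
    using e that root cnj_root_of_unity by blast+
  let ?P = "twisted_perm_mat ?G (act_X g) (\<lambda>x. \<psi> (e x))"
  \<comment> \<open>\<open>Q\<close> enters the product as its conjugate transpose, hence the conjugate.\<close>
  let ?Q = "twisted_perm_mat ?G (act_Y g) (\<lambda>y. cnj (\<psi> (e' y)))"
  have "fixes_mat ?G ?G ?A (?P, ?Q)"
    by (rule twisted_perm_mat_fixes) (use bij Amat A in simp_all)
  hence "(?P, ?Q) \<in> Automorphisms n ?G ?G ?A"
    using twisted_perm_mat_monomial[OF bij(1)] twisted_perm_mat_monomial[OF bij(2)] e1
    by (simp add: Automorphisms_def)
  moreover have "(abs_mat ?P, abs_mat ?Q) = GL_perm (card I) g"
    using abs_twisted_perm_mat[of ?G "\<lambda>x. \<psi> (e x)" "act_X g"]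
      abs_twisted_perm_mat[of ?G "\<lambda>y. cnj (\<psi> (e' y))" "act_Y g"]
      cmod_root_of_unity[OF e1(1) n_pos] cmod_root_of_unity[OF e1(2) n_pos]
    by (simp add: GL_perm_def)
  ultimately show ?lift by blast
  have "fixes_mat ?G ?G (abs_mat ?A) (perm_mat ?G (act_X g), perm_mat ?G (act_Y g))"
    unfolding perm_mat_eq_twisted
  proof (rule twisted_perm_mat_fixes)
    show "abs_mat ?A \<in> matrices ?G ?G" using Amat by (auto simp: matrices_def abs_mat_def)
    show "abs_mat ?A (act_X g x) (act_Y g y) = 1 * abs_mat ?A x y * cnj 1"
      if "x \<in> ?G" "y \<in> ?G" for x y
      using e that by (simp add: abs_mat_def A[OF that] norm_mult cmod_character)
  qed (use bij in simp_all)
  thus ?perm using bij by (auto simp: PermAut_def GL_perm_def perm_matrices_def)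
qed

end

theorem theorem6p9:
  fixes q d k n :: nat
  assumes "q = CARD('f::{field,finite})" and "d = CARD('d::finite)"
    and "0 < k" and "k < d"
    and "1 < n" and "n dvd (q - 1)"
  shows "\<exists>N (A :: ('f ^ 'd) set \<Rightarrow> ('f ^ 'd) set \<Rightarrow> complex).
    real N = gaussian_binomial q d k \<and>
    A \<in> GW (Gr k) (Gr k) N (q ^ (k * (d - k))) n \<and>
    (\<exists>p \<in> Gr k \<times> Gr k.
       GL_orbit p = {(x, y). x \<in> Gr k \<and> y \<in> Gr k \<and> x \<inter> dual_space y = {0}} \<and>
       abs_mat A = char_mat (GL_orbit p)) \<and>
    GL_perm k ` GL \<subseteq> PermAut (Gr k) (Gr k) (abs_mat A) \<and>
    (\<forall>p \<in> GL_perm k ` GL.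
       \<exists>(P, Q) \<in> Automorphisms n (Gr k) (Gr k) A. (abs_mat P, abs_mat Q) = p)"
proof -
  have "n dvd (CARD('f) - 1)" using assms(1,6) by simp
  from exists_multiplicative_character[OF assms(5) this]
  obtain \<psi> :: "'f \<Rightarrow> complex" where
    "(\<forall>x y. \<psi> (x * y) = \<psi> x * \<psi> y) \<and> \<psi> 0 = 0 \<and>
     (\<forall>x. x \<noteq> 0 \<longrightarrow> \<psi> x \<in> roots_of_unity n) \<and> (\<exists>c. c \<noteq> 0 \<and> \<psi> c \<noteq> 1)"
    by (rule exE)
  then interpret root_of_unity_character \<psi> n
    using assms(5) by unfold_locales auto
  obtain I :: "'d set" where I: "card I = k"
    using obtain_subset_with_card_n[of k "UNIV :: 'd set"] assms(2,4) by auto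
  let ?A = "weighing_matrix I :: ('f ^ 'd) set \<Rightarrow> ('f ^ 'd) set \<Rightarrow> complex"
  let ?E = "coordinate_space I :: ('f ^ 'd) set"
  show ?thesis
  proof (intro exI[of _ "card (Gr k :: ('f ^ 'd) set set)"] exI[of _ ?A] conjI ballI)
    show "real (card (Gr k :: ('f ^ 'd) set set)) = gaussian_binomial q d k"
      unfolding assms(1,2) by (rule card_Gr_gaussian_binomial) (use assms(2,4) in simp)
    show "?A \<in> GW (Gr k) (Gr k) (card (Gr k :: ('f ^ 'd) set set)) (q ^ (k * (d - k))) n"
      using weighing_matrix_GW[of I] by (simp only: I assms(1,2))
    have "GL_orbit (?E, ?E) = {(x, y). x \<in> Gr k \<and> y \<in> Gr k \<and> x \<inter> dual_space y = {0}}"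
      using GL_orbit_coordinate_space[of I] by (simp only: I)
    moreover have "abs_mat ?A =
        char_mat {(x, y). x \<in> Gr k \<and> y \<in> Gr k \<and> x \<inter> dual_space y = {0}}"
      using abs_weighing_matrix[of I] by (simp only: I)
    moreover have "(?E, ?E) \<in> Gr k \<times> Gr k"
      using coordinate_space_Gr[of I] by (simp add: I)
    ultimately show "\<exists>p \<in> Gr k \<times> Gr k.
        GL_orbit p = {(x, y). x \<in> Gr k \<and> y \<in> Gr k \<and> x \<inter> dual_space y = {0}} \<and>
        abs_mat ?A = char_mat (GL_orbit p)"
      by (intro bexI[of _ "(?E, ?E)"]) simp_all
    show "GL_perm k ` GL \<subseteq> PermAut (Gr k) (Gr k) (abs_mat ?A)"
      using GL_lifts(1)[of _ I] by (auto simp: GL_def I)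
    show "\<exists>(P, Q) \<in> Automorphisms n (Gr k) (Gr k) ?A. (abs_mat P, abs_mat Q) = p"
      if "p \<in> GL_perm k ` GL" for p
      using GL_lifts(2)[of _ I] that by (auto simp: GL_def I)
  qed
qed

end
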